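(* There is a universal constant $c>0$ such that for every fixed polylogarithmic function $L(s)=C(1+\log s)^k$ (with $C,k>0$) there is $s_0$ for which the following holds. Let $P\neq Q$ be weakly disjoint distributions on $[n]$ and let $s\ge s_0$ be an integer with $$s\ \le\ \min\left\{\frac{0.25}{\|P-Q\|_3},\ \frac1{\|P\|_\infty},\ \frac1{\|Q\|_\infty},\ \frac1c\cdot\frac{\|P+Q\|_2}{\|P-Q\|_2^2}\right\}.$$ Then no algorithm solves the distinguishability problem with $s$ samples and error $L(s)/s^2$ for the class of distribution pairs $\mathcal P=\{(\pi P,\pi Q):\ \pi \text{ a permutation of } [n]\}$.
   Context: Distributions on $[n]=\{1,\dots,n\}$ are identified with vectors; $\|\cdot\|_2,\|\cdot\|_3,\|\cdot\|_\infty$ are the usual $\ell_p$ norms of vectors. For a permutation $\pi$ of $[n]$, $\pi P$ is the distribution obtained from $P$ by relabelling the elements of $[n]$ by $\pi$ (the same $\pi$ is applied to both $P$ and $Q$). Weakly disjoint: distributions $P=(p_x)$ and $Q=(q_x)$ are weakly disjoint if every element $x$ satisfies one of: (1) $p_x=q_x$; (2) $p_x>0$ and $q_x=0$; (3) $q_x>0$ and $p_x=0$. Distinguishability problem: given $s$ samples from $X$ and $s$ samples from $Y$ (training phase), and $s$ samples from a distribution $T$ which is either $X$ or $Y$ (testing phase), all samples independent, output whether the first distribution ($X$) or the second ($Y$) generated the testing sample. A (possibly randomized) algorithm, seeing only the samples, solves the distinguishability problem for a class $\mathcal P$ of distribution pairs with $s$ samples and error $\varepsilon$ if for every $(X,Y)\in\mathcal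 P$ and both choices of $T$ it outputs the correct answer with probability at least $1-\varepsilon$; and further, if $X$ and $Y$ are identical, it outputs "first" and "second" each with probability at least $0.5-\varepsilon$. In the paper the error is $\varepsilon=\mathrm{polylog}(s)/s^2$. *)

theory Defs
  imports "HOL-Probability.Probability"
begin

text \<open>
  A distribution on \<open>[n]\<close> is a \<^typ>\<open>nat pmf\<close> whose support lies in \<open>{1..n}\<close>; its vector is
  \<open>pmf P\<close> restricted to \<open>{1..n}\<close>. The carrier is explicit because \<open>n\<close> is quantified inside the
  result: the threshold on the sample size must not depend on \<open>n\<close>.
\<close>

definition dist_on :: "nat \<Rightarrow> nat pmf \<Rightarrow> bool" where
  "dist_on n P \<longleftrightarrow> set_pmf P \<subseteq> {1..n}"

definition lp_norm :: "nat \<Rightarrow> nat \<Rightarrow> (nat \<Rightarrow> real) \<Rightarrow> real" where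
  "lp_norm p n v = root p (\<Sum>x\<in>{1..n}. \<bar>v x\<bar> ^ p)"

text \<open>Only meaningful for \<open>n \<ge> 1\<close>, which holds whenever some distribution on \<open>[n]\<close> exists.\<close>

definition linf_norm :: "nat \<Rightarrow> (nat \<Rightarrow> real) \<Rightarrow> real" where
  "linf_norm n v = Max ((\<lambda>x. \<bar>v x\<bar>) ` {1..n})"

lemma lp_norm_2: "lp_norm 2 n v = L2_set v {1..n}"
  by (simp add: lp_norm_def L2_set_def sqrt_def)

lemma dist_on_nonempty: "dist_on n P \<Longrightarrow> n \<ge> 1"
  using set_pmf_not_empty[of P] by (fastforce simp: dist_on_def)

definition weakly_disjoint :: "nat pmf \<Rightarrow> nat pmf \<Rightarrow> bool" where
  "weakly_disjoint P Q \<longleftrightarrow>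
     (\<forall>x. pmf P x = pmf Q x \<or> (pmf P x > 0 \<and> pmf Q x = 0) \<or> (pmf Q x > 0 \<and> pmf P x = 0))"

datatype answer = First | Second

text \<open>
  A randomized algorithm sees the two training samples and the testing sample and returns a
  random answer.  All sample spaces are discrete, so a \<^typ>\<open>answer pmf\<close>-valued function
  describes every randomized algorithm.
\<close>

type_synonym algorithm = "nat list \<Rightarrow> nat list \<Rightarrow> nat list \<Rightarrow> answer pmf"

definition output_dist :: "algorithm \<Rightarrow> nat \<Rightarrow> nat pmf \<Rightarrow> nat pmf \<Rightarrow> nat pmf \<Rightarrow> answer pmf" where
  "output_dist A s X Y T =
     do { xs \<leftarrow> replicate_pmf s X;
          ys \<leftarrow> replicate_pmf s Y;
          ts \<leftarrow> replicate_pmf s T;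
          A xs ys ts }"

text \<open>
  The requirement for identical \<open>X\<close> and \<open>Y\<close> is imposed for every distribution on \<open>[n]\<close>, not only
  for identical pairs in the class \<open>\<P>\<close>: on such a pair the first requirement would ask for two
  complementary answers, each with probability at least \<open>1 - \<epsilon>\<close>.
\<close>

definition solves_distinguishability ::
    "nat \<Rightarrow> (nat pmf \<times> nat pmf) set \<Rightarrow> nat \<Rightarrow> real \<Rightarrow> algorithm \<Rightarrow> bool" where
  "solves_distinguishability n \<P> s \<epsilon> A \<longleftrightarrow>
     (\<forall>(X, Y)\<in>\<P>. pmf (output_dist A s X Y X) First \<ge> 1 - \<epsilon>
               \<and> pmf (output_dist A s X Y Y) Second \<ge> 1 - \<epsilon>) \<and>
     (\<forall>X. dist_on n X \<longrightarrow>
            pmf (output_dist A s X X X) First \<ge> 0.5 - \<epsilon>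
          \<and> pmf (output_dist A s X X X) Second \<ge> 0.5 - \<epsilon>)"

definition relabelling_class :: "nat \<Rightarrow> nat pmf \<Rightarrow> nat pmf \<Rightarrow> (nat pmf \<times> nat pmf) set" where
  "relabelling_class n P Q = {(map_pmf \<pi> P, map_pmf \<pi> Q) | \<pi>. \<pi> permutes {1..n}}"

end

theory Submission
  imports Defs "HOL-Combinatorics.Multiset_Permutations" "HOL-Real_Asymp.Real_Asymp"
begin

text \<open>
  Give the algorithm Poisson many samples, of mean \<open>2s\<close>, in each of the three phases: this only
  helps it, up to an exponentially small error, and makes the occurrence patterns \<open>(i, j, k)\<close>
  of distinct elements independent. Averaged over all relabellings, its output depends only on the
  multiset of nonzero patterns. The elements with \<open>p\<^sub>x = q\<^sub>x\<close> contribute a smooth random multiset: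
  adding one pattern of total at most 2 moves its law by \<open>O(1 / (s D))\<close> in total variation, where
  \<open>D\<close> is the 2-norm of their probabilities. On the other elements, triple collisions have
  probability at most \<open>1/6\<close> by the 3-norm bound, and each of the \<open>O(s\<^sup>2 \<parallel>P - Q\<parallel>\<^sub>2\<^sup>2)\<close> expected double
  collisions can be split into two singletons at cost \<open>O(1 / (s D))\<close>. Once they are split, only the
  numbers of samples matter, and these have the same law for \<open>T = X\<close> and \<open>T = Y\<close>. So the two laws are
  at total variation distance below \<open>1/2\<close>, and no algorithm has small error.
\<close>

text \<open>What betrays \<open>T\<close> is a coincidence between phases: an element with different
  probabilities showing (1, 0, 1) or (0, 1, 1). Elements of equal probability show the same patterns
  by chance. The expected number \<open>m\<close> of them with a given pattern of total 1 or 2 is at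
  least of order \<open>s\<^sup>2 D\<^sup>2\<close>, and it fluctuates by about
  \<open>sqrt m\<close>, so one pattern more is lost in the noise up to \<open>1 / sqrt m\<close>.
  This needs the rates \<open>2 s p_x\<close> of these elements to be bounded, which is where the
  sup norm enters: an element must stay unseen with probability bounded below. The splits together
  cost about \<open>s \<parallel>P - Q\<parallel>\<^sup>2 / D\<close> in 2-norms. Weak disjointness
  turns the fourth bound on \<open>s\<close> into a bound on this quantity, because then
  \<open>\<parallel>P + Q\<parallel>\<^sup>2 = 4 D\<^sup>2 + \<parallel>P -
  Q\<parallel>\<^sup>2\<close>. Total variation never appears as such: laws are compared through an
  arbitrary test function \<open>G\<close> with values in [0, 1], which the algorithm itself
  supplies.\<close>

section \<open>Expectations of bounded functions\<close>

abbreviation expect :: "'a pmf \<Rightarrow> ('a \<Rightarrow> real) \<Rightarrow> real" where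
  "expect \<equiv> measure_pmf.expectation"

lemma integrable_pmf_bounded:
  fixes f :: "'a \<Rightarrow> real"
  assumes "\<And>x. \<bar>f x\<bar> \<le> B"
  shows "integrable (measure_pmf M) f"
  by (rule measure_pmf.integrable_const_bound[where B = B]) (use assms in auto)

lemma expect_mono_bounded:
  fixes f g :: "'a \<Rightarrow> real"
  assumes "\<And>x. \<bar>f x\<bar> \<le> B" "\<And>x. \<bar>g x\<bar> \<le> C" "\<And>x. x \<in> set_pmf M \<Longrightarrow> f x \<le> g x"
  shows "expect M f \<le> expect M g"
  by (rule integral_mono_AE) (use assms in \<open>auto intro!: integrable_pmf_bounded simp: AE_measure_pmf_iff\<close>)

lemma abs_expect_le:
  fixes f :: "'a \<Rightarrow> real"
  assumes "\<And>x. \<bar>f x\<bar> \<le> B"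
  shows "\<bar>expect M f\<bar> \<le> B"
proof -
  have "\<bar>expect M f\<bar> \<le> expect M (\<lambda>x. \<bar>f x\<bar>)"
    by (rule integral_abs_bound)
  also have "\<dots> \<le> expect M (\<lambda>_. B)"
    using assms order_trans[OF abs_ge_zero assms]
    by (intro expect_mono_bounded[where B = B and C = B]) auto
  finally show ?thesis by simp
qed

lemma expect_cong:
  "(\<And>x. x \<in> set_pmf M \<Longrightarrow> f x = g x) \<Longrightarrow> expect M f = expect M g"
  by (intro integral_cong_AE) (auto simp: AE_measure_pmf_iff)

lemma expect_bind:
  fixes f :: "'b \<Rightarrow> real"
  assumes "\<And>x. \<bar>f x\<bar> \<le> B"
  shows "expect (bind_pmf M K) f = expect M (\<lambda>x. expect (K x) f)"
  unfolding measure_pmf_bind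
  by (rule integral_bind[where K = "count_space UNIV" and B = B and B' = 1])
     (use assms in \<open>auto simp: measure_pmf_in_subprob_algebra measure_pmf.emeasure_space_1\<close>)

lemma expect_pair:
  fixes f :: "'a \<times> 'b \<Rightarrow> real"
  assumes "\<And>x. \<bar>f x\<bar> \<le> B"
  shows "expect (pair_pmf M N) f = expect M (\<lambda>x. expect N (\<lambda>y. f (x, y)))"
  unfolding pair_pmf_def using assms by (simp add: expect_bind[where B = B])

lemma expect_Pi_insert:
  fixes f :: "('a \<Rightarrow> 'b) \<Rightarrow> real"
  assumes "finite A" "x \<notin> A" "\<And>c. \<bar>f c\<bar> \<le> B"
  shows "expect (Pi_pmf (insert x A) z p) f
       = expect (p x) (\<lambda>y. expect (Pi_pmf A z p) (\<lambda>c. f (c(x := y))))"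
  using assms by (simp add: Pi_pmf_insert expect_pair[where B = B])

lemma expect_indicator_mult:
  "expect M (\<lambda>x. of_bool (x = v) * C) = pmf M v * C"
  "expect M (\<lambda>x. of_bool (x = v)) = pmf M v"
proof -
  have "expect M (\<lambda>x. of_bool (x = v) :: real) = expect M (indicator {v})"
    by (intro expect_cong) (auto simp: indicator_def)
  then show "expect M (\<lambda>x. of_bool (x = v)) = pmf M v"
    by (simp add: measure_pmf_single)
  then show "expect M (\<lambda>x. of_bool (x = v) * C) = pmf M v * C"
    by simp
qed

lemma expect_abs_le_sqrt:
  fixes f :: "'a \<Rightarrow> real"
  assumes "\<And>x. \<bar>f x\<bar> \<le> B"
  shows "expect M (\<lambda>x. \<bar>f x\<bar>) \<le> sqrt (expect M (\<lambda>x. (f x)\<^sup>2))"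
proof -
  have B: "(f x)\<^sup>2 \<le> B\<^sup>2" for x
    by (rule abs_le_square_iff[THEN iffD1]) (use assms[of x] in auto)
  have "0 \<le> measure_pmf.variance M (\<lambda>x. \<bar>f x\<bar>)"
    by (rule Bochner_Integration.integral_nonneg) auto
  also have "\<dots> = expect M (\<lambda>x. \<bar>f x\<bar>\<^sup>2) - (expect M (\<lambda>x. \<bar>f x\<bar>))\<^sup>2"
    by (rule measure_pmf.variance_eq)
       (use assms B in \<open>auto intro: integrable_pmf_bounded[where B = B] integrable_pmf_bounded[where B = "B\<^sup>2"]\<close>)
  finally show ?thesis by (intro real_le_rsqrt) simp
qed

text \<open>Variances of independent summands add, and each is at most the second moment. The
  induction adds one coordinate at a time.\<close>

lemma expect_square_sum_Pi:
  fixes f :: "'a \<Rightarrow> 'b \<Rightarrow> real"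
  assumes "finite D" and bd: "\<And>d y. \<bar>f d y\<bar> \<le> B" and B: "B \<ge> 0"
  shows "expect (Pi_pmf D z p) (\<lambda>c. (\<Sum>d\<in>D. f d (c d) - expect (p d) (f d))\<^sup>2)
       \<le> (\<Sum>d\<in>D. expect (p d) (\<lambda>y. (f d y)\<^sup>2))"
  using assms(1)
proof (induction D rule: finite_induct)
  case (insert x D)
  define S where "S c = (\<Sum>d\<in>D. f d (c d) - expect (p d) (f d))" for c
  define Y where "Y y = f x y - expect (p x) (f x)" for y
  have ab: "\<bar>expect (p d) (f d)\<bar> \<le> B" for d by (rule abs_expect_le) (rule bd)
  have dev1: "\<bar>f d y - expect (p d) (f d)\<bar> \<le> 2 * B" for d y
    using bd[of d y] ab[of d] by linarith
  then have Yb: "\<bar>Y y\<bar> \<le> 2 * B" for y by (simp add: Y_def)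
  have Sb: "\<bar>S c\<bar> \<le> card D * (2 * B)" for c
    unfolding S_def by (rule order_trans[OF sum_abs]) (rule sum_bounded_above, rule dev1)
  define b where "b = card D * (2 * B)"
  have b0: "b \<ge> 0" using B by (simp add: b_def)
  have Sb: "\<bar>S c\<bar> \<le> b" for c using Sb by (simp add: b_def)
  have sq: "u\<^sup>2 \<le> w\<^sup>2" if "\<bar>u\<bar> \<le> w" for u w :: real
    by (rule abs_le_square_iff[THEN iffD1]) (use that in auto)
  have upd: "(\<Sum>d\<in>insert x D. f d ((c(x := y)) d) - expect (p d) (f d)) = Y y + S c" for y c
  proof -
    have "(\<Sum>d\<in>D. f d ((c(x := y)) d) - expect (p d) (f d)) = S c"
      unfolding S_def using insert by (intro sum.cong) auto
    then show ?thesis using insert by (simp add: Y_def)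
  qed
  have tot: "\<bar>(\<Sum>d\<in>insert x D. f d (c d) - expect (p d) (f d))\<bar> \<le> card (insert x D) * (2 * B)" for c
    by (rule order_trans[OF sum_abs]) (rule sum_bounded_above, rule dev1)
  \<comment> \<open>The centred summand has mean zero, which kills the cross term of
    \<open>ES\<close> whatever the mean of \<open>S\<close> is.\<close>
  have EY: "expect (p x) Y = 0"
    unfolding Y_def by (subst Bochner_Integration.integral_diff) (auto intro!: integrable_pmf_bounded bd)
  have ES: "expect (Pi_pmf D z p) (\<lambda>c. (Y y + S c)\<^sup>2)
      = (Y y)\<^sup>2 + 2 * Y y * expect (Pi_pmf D z p) S + expect (Pi_pmf D z p) (\<lambda>c. (S c)\<^sup>2)" for y
  proof -
    have "expect (Pi_pmf D z p) (\<lambda>c. (Y y + S c)\<^sup>2)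
        = expect (Pi_pmf D z p) (\<lambda>c. (Y y)\<^sup>2 + 2 * Y y * S c + (S c)\<^sup>2)"
      by (simp add: power2_sum algebra_simps)
    also have "\<dots> = (Y y)\<^sup>2 + 2 * Y y * expect (Pi_pmf D z p) S + expect (Pi_pmf D z p) (\<lambda>c. (S c)\<^sup>2)"
      using integrable_pmf_bounded[of S b "Pi_pmf D z p", OF Sb]
        integrable_pmf_bounded[of "\<lambda>c. (S c)\<^sup>2" "b\<^sup>2" "Pi_pmf D z p"] sq[OF Sb]
      by simp
    finally show ?thesis .
  qed
  have iY: "integrable (measure_pmf (p x)) Y" by (rule integrable_pmf_bounded) (rule Yb)
  have iY2: "integrable (measure_pmf (p x)) (\<lambda>y. (Y y)\<^sup>2)"
    by (rule integrable_pmf_bounded[where B = "(2 * B)\<^sup>2"]) (use sq[OF Yb] in auto)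
  have intf: "integrable (measure_pmf (p x)) (f x)" by (rule integrable_pmf_bounded) (rule bd)
  have intf2: "integrable (measure_pmf (p x)) (\<lambda>y. (f x y)\<^sup>2)"
    by (rule integrable_pmf_bounded[where B = "B\<^sup>2"]) (use sq[OF bd] in auto)
  have "expect (Pi_pmf (insert x D) z p) (\<lambda>c. (\<Sum>d\<in>insert x D. f d (c d) - expect (p d) (f d))\<^sup>2)
      = expect (p x) (\<lambda>y. expect (Pi_pmf D z p) (\<lambda>c. (Y y + S c)\<^sup>2))"
    by (subst expect_Pi_insert[where B = "(card (insert x D) * (2 * B))\<^sup>2"])
       (use insert sq[OF tot] upd in auto)
  also have "\<dots> = expect (p x) (\<lambda>y. (Y y)\<^sup>2) + expect (Pi_pmf D z p) (\<lambda>c. (S c)\<^sup>2)"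
    using iY iY2 EY by (simp add: ES)
  also have "expect (p x) (\<lambda>y. (Y y)\<^sup>2) = expect (p x) (\<lambda>y. (f x y)\<^sup>2) - (expect (p x) (f x))\<^sup>2"
    unfolding Y_def by (rule measure_pmf.variance_eq[OF intf intf2])
  also have "\<dots> \<le> expect (p x) (\<lambda>y. (f x y)\<^sup>2)" by simp
  also have "expect (Pi_pmf D z p) (\<lambda>c. (S c)\<^sup>2) \<le> (\<Sum>d\<in>D. expect (p d) (\<lambda>y. (f d y)\<^sup>2))"
    using insert.IH by (simp add: S_def)
  finally show ?case using insert by (simp add: add.commute)
qed simp

section \<open>Smoothness of the multiset of nonzero patterns\<close>

text \<open>An unseen element leaves no trace, so turning one element's pattern from 0 into
  \<open>v\<close> adds exactly \<open>v\<close> to the multiset.\<close>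

definition single :: "'b::zero \<Rightarrow> 'b multiset" where
  "single y = (if y = 0 then {#} else {#y#})"

definition nonzero_patterns :: "'a set \<Rightarrow> ('a \<Rightarrow> 'b::zero) \<Rightarrow> 'b multiset" where
  "nonzero_patterns D c = (\<Sum>d\<in>D. single (c d))"

lemma nonzero_patterns_upd:
  assumes "finite D" "d \<notin> D"
  shows "nonzero_patterns (insert d D) (c(d := y)) = single y + nonzero_patterns D c"
proof -
  have "nonzero_patterns D (c(d := y)) = nonzero_patterns D c"
    unfolding nonzero_patterns_def using assms by (intro sum.cong) auto
  then show ?thesis using assms by (simp add: nonzero_patterns_def)
qed

text \<open>
  Stein's exchange: with \<open>W\<close> the number of \<open>d\<close> whose pattern is \<open>v\<close>, and \<open>W'\<close> the sum of
  \<open>pmf (p d) v / pmf (p d) 0\<close> over the \<open>d\<close> whose pattern is \<open>0\<close>, independence gives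
  \<open>E[W G(M)] = E[W' G(M + {v})]\<close>. Both \<open>W\<close> and \<open>W'\<close> have mean \<open>m\<close> and variance \<open>O(m)\<close>.
\<close>

lemma nonzero_patterns_shift:
  fixes p :: "'a \<Rightarrow> 'b::zero pmf" and G :: "'b multiset \<Rightarrow> real"
  assumes fin: "finite D" and v: "v \<noteq> 0"
    and G: "\<And>U. \<bar>G U\<bar> \<le> 1"
    and z: "\<And>d. d \<in> D \<Longrightarrow> pmf (p d) 0 > 0"
    and R: "\<And>d. d \<in> D \<Longrightarrow> pmf (p d) v \<le> R * pmf (p d) 0"
    and R0: "R \<ge> 0"
    and m: "m = (\<Sum>d\<in>D. pmf (p d) v)" "m > 0"
  shows "\<bar>expect (Pi_pmf D 0 p) (\<lambda>c. G (nonzero_patterns D c + {#v#}))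
        - expect (Pi_pmf D 0 p) (\<lambda>c. G (nonzero_patterns D c))\<bar> \<le> (1 + sqrt R) / sqrt m"
proof -
  define r where "r d = pmf (p d) v / pmf (p d) 0" for d
  define \<mu> where "\<mu> = Pi_pmf D 0 p"
  define N where "N c = nonzero_patterns D c" for c :: "'a \<Rightarrow> 'b"
  define f where "f d y = (if d \<in> D then of_bool (y = v) else (0::real))" for d and y :: 'b
  define g where "g d y = (if d \<in> D then r d * of_bool (y = 0) else (0::real))" for d and y :: 'b
  define W where "W c = (\<Sum>d\<in>D. f d (c d))" for c
  define W' where "W' c = (\<Sum>d\<in>D. g d (c d))" for c
  have r0: "r d \<ge> 0" for d by (simp add: r_def)
  have rR: "r d \<le> R" if "d \<in> D" for d
    using R[OF that] z[OF that] by (simp add: r_def divide_simps mult.commute)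
  have rz: "r d * pmf (p d) 0 = pmf (p d) v" if "d \<in> D" for d
    using z[OF that] by (simp add: r_def)
  \<comment> \<open>With the coordinate \<open>d\<close> integrated out, both sides are
    \<open>pmf (p d) v\<close> times the same \<open>H\<close>: on the left \<open>d\<close> itself
    supplies the pattern \<open>v\<close>, on the right \<open>d\<close> is unseen and
    \<open>v\<close> is added by hand.\<close>
  have exchange: "expect \<mu> (\<lambda>c. f d (c d) * G (N c)) = expect \<mu> (\<lambda>c. g d (c d) * G (N c + {#v#}))"
    if d: "d \<in> D" for d
  proof -
    define D' where "D' = D - {d}"
    have D: "D = insert d D'" "finite D'" "d \<notin> D'" using d fin by (auto simp: D'_def)
    define H where "H = expect (Pi_pmf D' 0 p) (\<lambda>c. G (nonzero_patterns D' c + {#v#}))"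
    have "expect \<mu> (\<lambda>c. f d (c d) * G (N c))
        = expect (p d) (\<lambda>y. expect (Pi_pmf D' 0 p) (\<lambda>c. f d y * G (single y + nonzero_patterns D' c)))"
      unfolding \<mu>_def N_def D(1)
      by (subst expect_Pi_insert[where B = 1])
         (use D G in \<open>auto simp: nonzero_patterns_upd f_def\<close>)
    also have "\<dots> = expect (p d) (\<lambda>y. of_bool (y = v) * H)"
      by (intro expect_cong) (auto simp: f_def d H_def single_def v)
    also have "\<dots> = pmf (p d) v * H" by (rule expect_indicator_mult)
    finally have 1: "expect \<mu> (\<lambda>c. f d (c d) * G (N c)) = pmf (p d) v * H" .
    have "expect \<mu> (\<lambda>c. g d (c d) * G (N c + {#v#}))
        = expect (p d) (\<lambda>y. expect (Pi_pmf D' 0 p)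
            (\<lambda>c. g d y * G (single y + nonzero_patterns D' c + {#v#})))"
      unfolding \<mu>_def N_def D(1)
      by (subst expect_Pi_insert[where B = "\<bar>r d\<bar>"])
         (use D G in \<open>auto simp: nonzero_patterns_upd g_def abs_mult intro!: mult_left_le\<close>)
    also have "\<dots> = expect (p d) (\<lambda>y. of_bool (y = 0) * (r d * H))"
      by (intro expect_cong) (auto simp: g_def d H_def single_def v)
    also have "\<dots> = pmf (p d) v * H" by (subst expect_indicator_mult) (simp add: rz[OF d, symmetric])
    finally show ?thesis using 1 by simp
  qed
  define B where "B = max 1 R"
  have fb: "\<bar>f d y\<bar> \<le> B" and gb: "\<bar>g d y\<bar> \<le> B" for d y
    using rR[of d] r0[of d] by (auto simp: f_def g_def B_def)
  have B0: "B \<ge> 0" by (simp add: B_def)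
  have Wb: "\<bar>W c\<bar> \<le> card D * B" "\<bar>W' c\<bar> \<le> card D * B" for c
    unfolding W_def W'_def
    by (rule order_trans[OF sum_abs], rule sum_bounded_above, simp add: fb gb)+
  have Ef: "expect (p d) (f d) = pmf (p d) v" if "d \<in> D" for d
  proof -
    have "expect (p d) (f d) = expect (p d) (\<lambda>y. of_bool (y = v))"
      by (intro expect_cong) (simp add: f_def that)
    then show ?thesis by (simp only: expect_indicator_mult)
  qed
  have Eg: "expect (p d) (g d) = pmf (p d) v" if "d \<in> D" for d
  proof -
    have "expect (p d) (g d) = expect (p d) (\<lambda>y. of_bool (y = 0) * r d)"
      by (intro expect_cong) (simp add: g_def that)
    with rz[OF that] show ?thesis unfolding expect_indicator_mult by (simp add: mult.commute)
  qed
  have GN: "\<bar>a * G U\<bar> \<le> C" if "\<bar>a\<bar> \<le> C" for a C U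
    using that G[of U] by (simp add: abs_mult) (meson abs_ge_zero mult_left_le order_trans)
  have int: "integrable \<mu> (\<lambda>c. h c * G (k c))" if "\<And>c. \<bar>h c\<bar> \<le> C" for h k C
    by (rule integrable_pmf_bounded[where B = C]) (rule GN, rule that)
  have EW: "expect \<mu> (\<lambda>c. W c * G (N c)) = expect \<mu> (\<lambda>c. W' c * G (N c + {#v#}))"
  proof -
    have "expect \<mu> (\<lambda>c. W c * G (N c)) = (\<Sum>d\<in>D. expect \<mu> (\<lambda>c. f d (c d) * G (N c)))"
      unfolding W_def sum_distrib_right by (rule Bochner_Integration.integral_sum) (rule int, rule fb)
    also have "\<dots> = (\<Sum>d\<in>D. expect \<mu> (\<lambda>c. g d (c d) * G (N c + {#v#})))"
      by (intro sum.cong refl exchange)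
    also have "\<dots> = expect \<mu> (\<lambda>c. W' c * G (N c + {#v#}))"
      unfolding W'_def sum_distrib_right
      by (rule Bochner_Integration.integral_sum[symmetric]) (rule int, rule gb)
    finally show ?thesis .
  qed
  have dev: "\<bar>expect \<mu> (\<lambda>c. (F c - m) * G (k c))\<bar> \<le> sqrt V"
    if "\<And>c. \<bar>F c\<bar> \<le> card D * B" "expect \<mu> (\<lambda>c. (F c - m)\<^sup>2) \<le> V" for F k V
  proof -
    have b: "\<bar>F c - m\<bar> \<le> card D * B + m" for c using that(1)[of c] m(2) by linarith
    have "\<bar>expect \<mu> (\<lambda>c. (F c - m) * G (k c))\<bar> \<le> expect \<mu> (\<lambda>c. \<bar>(F c - m) * G (k c)\<bar>)"
      by (rule integral_abs_bound)
    also have "\<dots> \<le> expect \<mu> (\<lambda>c. \<bar>F c - m\<bar>)"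
      by (rule expect_mono_bounded[where B = "card D * B + m" and C = "card D * B + m"])
         (use GN[OF b] b GN[OF order_refl] in auto)
    also have "\<dots> \<le> sqrt (expect \<mu> (\<lambda>c. (F c - m)\<^sup>2))"
      by (rule expect_abs_le_sqrt) (rule b)
    also have "\<dots> \<le> sqrt V" using that(2) by simp
    finally show ?thesis .
  qed
  have 1: "\<bar>expect \<mu> (\<lambda>c. (W c - m) * G (N c))\<bar> \<le> sqrt m"
  proof (rule dev[OF Wb(1)])
    have "expect \<mu> (\<lambda>c. (W c - m)\<^sup>2) = expect \<mu> (\<lambda>c. (\<Sum>d\<in>D. f d (c d) - expect (p d) (f d))\<^sup>2)"
      by (simp add: W_def m sum_subtractf Ef)
    also have "\<dots> \<le> (\<Sum>d\<in>D. expect (p d) (\<lambda>y. (f d y)\<^sup>2))"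
      unfolding \<mu>_def by (rule expect_square_sum_Pi) (use fin fb B0 in auto)
    also have "\<dots> = m"
      unfolding m
    proof (intro sum.cong refl)
      fix d assume d: "d \<in> D"
      have "expect (p d) (\<lambda>y. (f d y)\<^sup>2) = expect (p d) (f d)"
        by (intro expect_cong) (auto simp: f_def d)
      then show "expect (p d) (\<lambda>y. (f d y)\<^sup>2) = pmf (p d) v" by (simp add: Ef d)
    qed
    finally show "expect \<mu> (\<lambda>c. (W c - m)\<^sup>2) \<le> m" .
  qed
  \<comment> \<open>In the second moment of a summand of \<open>W'\<close>, one factor
    \<open>r d\<close> turns the probability of 0 into that of \<open>v\<close>; the other factor
    costs \<open>R\<close>.\<close>
  have 2: "\<bar>expect \<mu> (\<lambda>c. (W' c - m) * G (N c + {#v#}))\<bar> \<le> sqrt (R * m)"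
  proof (rule dev[OF Wb(2)])
    have "expect \<mu> (\<lambda>c. (W' c - m)\<^sup>2) = expect \<mu> (\<lambda>c. (\<Sum>d\<in>D. g d (c d) - expect (p d) (g d))\<^sup>2)"
      by (simp add: W'_def m sum_subtractf Eg)
    also have "\<dots> \<le> (\<Sum>d\<in>D. expect (p d) (\<lambda>y. (g d y)\<^sup>2))"
      unfolding \<mu>_def by (rule expect_square_sum_Pi) (use fin gb B0 in auto)
    also have "\<dots> = (\<Sum>d\<in>D. r d * pmf (p d) v)"
    proof (intro sum.cong refl)
      fix d assume d: "d \<in> D"
      have "expect (p d) (\<lambda>y. (g d y)\<^sup>2) = expect (p d) (\<lambda>y. of_bool (y = 0) * (r d)\<^sup>2)"
        by (intro expect_cong) (auto simp: g_def d)
      also have "\<dots> = r d * pmf (p d) v"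
        unfolding expect_indicator_mult by (simp add: rz[OF d, symmetric] power2_eq_square)
      finally show "expect (p d) (\<lambda>y. (g d y)\<^sup>2) = r d * pmf (p d) v" .
    qed
    also have "\<dots> \<le> (\<Sum>d\<in>D. R * pmf (p d) v)"
      by (intro sum_mono mult_right_mono rR) auto
    also have "\<dots> = R * m" by (simp add: m sum_distrib_left)
    finally show "expect \<mu> (\<lambda>c. (W' c - m)\<^sup>2) \<le> R * m" .
  qed
  have intG: "integrable \<mu> (\<lambda>c. G (k c))" for k
    by (rule integrable_pmf_bounded[where B = 1]) (rule G)
  have eq1: "expect \<mu> (\<lambda>c. (W c - m) * G (N c))
      = expect \<mu> (\<lambda>c. W c * G (N c)) - m * expect \<mu> (\<lambda>c. G (N c))"
    unfolding left_diff_distrib using int[OF Wb(1)] intG by (subst Bochner_Integration.integral_diff) auto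
  have eq2: "expect \<mu> (\<lambda>c. (W' c - m) * G (N c + {#v#}))
      = expect \<mu> (\<lambda>c. W' c * G (N c + {#v#})) - m * expect \<mu> (\<lambda>c. G (N c + {#v#}))"
    unfolding left_diff_distrib using int[OF Wb(2)] intG by (subst Bochner_Integration.integral_diff) auto
  \<comment> \<open>Replacing \<open>W\<close> and \<open>W'\<close> by their common mean
    \<open>m\<close> in the exchange identity leaves \<open>m\<close> times the shift, up to the two
    deviations bounded above.\<close>
  define \<Delta> where "\<Delta> = expect \<mu> (\<lambda>c. G (N c + {#v#})) - expect \<mu> (\<lambda>c. G (N c))"
  have "m * \<Delta> = expect \<mu> (\<lambda>c. (W c - m) * G (N c)) - expect \<mu> (\<lambda>c. (W' c - m) * G (N c + {#v#}))"
    unfolding eq1 eq2 EW \<Delta>_def by (simp add: algebra_simps)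
  then have "\<bar>m * \<Delta>\<bar> \<le> sqrt m + sqrt (R * m)" using 1 2 by linarith
  then have "m * \<bar>\<Delta>\<bar> \<le> sqrt m * (1 + sqrt R)"
    using m(2) by (simp add: abs_mult real_sqrt_mult algebra_simps)
  then have "sqrt m * (sqrt m * \<bar>\<Delta>\<bar>) \<le> sqrt m * (1 + sqrt R)"
    using m(2) by (simp flip: mult.assoc)
  then have "sqrt m * \<bar>\<Delta>\<bar> \<le> 1 + sqrt R" using m(2) by simp
  then show ?thesis using m(2) by (simp add: \<Delta>_def \<mu>_def N_def divide_simps mult.commute)
qed

section \<open>Poisson counts\<close>

text \<open>The library's Poisson distribution excludes rate 0, which occurs for elements outside a support.\<close>

definition pois :: "real \<Rightarrow> nat pmf" where
  "pois r = (if r \<le> 0 then return_pmf 0 else poisson_pmf r)"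

lemma pmf_pois: "r \<ge> 0 \<Longrightarrow> pmf (pois r) k = r ^ k / fact k * exp (- r)"
  by (cases "r = 0") (auto simp: pois_def indicator_def power_0_left)

lemma pois_add:
  assumes "a \<ge> 0" "b \<ge> 0"
  shows "map_pmf (\<lambda>(i, j). i + j) (pair_pmf (pois a) (pois b)) = pois (a + b)"
proof (rule pmf_eqI)
  fix k :: nat
  have vim: "(\<lambda>(i, j). i + j) -` {k} = (\<lambda>i. (i, k - i)) ` {..k}" by force
  have ex: "exp (- a - b) = exp (- a) * exp (- b)" by (simp flip: exp_add)
  have inj: "inj_on (\<lambda>i. (i, k - i)) {..k}" by (auto simp: inj_on_def)
  have "pmf (map_pmf (\<lambda>(i, j). i + j) (pair_pmf (pois a) (pois b))) k
      = (\<Sum>i\<le>k. pmf (pois a) i * pmf (pois b) (k - i))"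
    unfolding pmf_map vim
    by (subst measure_measure_pmf_finite) (auto simp: sum.reindex[OF inj] pmf_pair)
  also have "\<dots> = (\<Sum>i\<le>k. of_nat (k choose i) * a ^ i * b ^ (k - i)) / fact k * exp (- (a + b))"
    unfolding sum_divide_distrib sum_distrib_right
    by (intro sum.cong refl)
       (use assms in \<open>auto simp: pmf_pois binomial_fact ex\<close>)
  also have "\<dots> = pmf (pois (a + b)) k"
    using assms by (subst binomial_ring[symmetric]) (simp add: pmf_pois)
  finally show "pmf (map_pmf (\<lambda>(i, j). i + j) (pair_pmf (pois a) (pois b))) k = pmf (pois (a + b)) k" .
qed

text \<open>The tail is \<open>exp (- r)\<close> times the Lagrange remainder of the exponential
  series, whose factor \<open>exp t\<close> has \<open>t\<close> at most \<open>r\<close>.\<close>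

lemma pois_upper_tail:
  assumes "r \<ge> 0"
  shows "measure_pmf.prob (pois r) {k..} \<le> r ^ k / fact k"
proof -
  obtain t where t: "\<bar>t\<bar> \<le> \<bar>r\<bar>" "exp r = (\<Sum>m<k. r ^ m / fact m) + exp t / fact k * r ^ k"
    using Maclaurin_exp_le[of r k] by blast
  have "measure_pmf.prob (pois r) {k..} = 1 - measure_pmf.prob (pois r) {..<k}"
    using measure_pmf.prob_compl[of "{..<k}" "pois r"] by (simp add: Compl_eq_Diff_UNIV[symmetric] not_less)
  also have "measure_pmf.prob (pois r) {..<k} = (\<Sum>m<k. r ^ m / fact m) * exp (- r)"
    using assms by (simp add: measure_measure_pmf_finite pmf_pois sum_distrib_right)
  also have "1 - \<dots> = exp (- r) * (exp r - (\<Sum>m<k. r ^ m / fact m))"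
    by (simp add: exp_minus field_simps)
  also have "\<dots> = exp (t - r) * (r ^ k / fact k)"
    by (simp add: t(2) exp_diff exp_minus field_simps)
  also have "\<dots> \<le> 1 * (r ^ k / fact k)"
    using t(1) assms by (intro mult_right_mono) auto
  finally show ?thesis by simp
qed

text \<open>A Chernoff bound: for \<open>m < s\<close> the factor \<open>2 ^ m\<close> is at most
  \<open>2 ^ s\<close>, and what remains is a partial sum of \<open>exp s\<close>. Doubling the mean
  from \<open>s\<close> to \<open>2 s\<close> is what makes the bound decay, since 2 is less than
  e.\<close>

lemma pois_lower_tail: "measure_pmf.prob (pois (2 * real s)) {..<s} \<le> (2 / exp 1) ^ s"
proof -
  obtain t where t: "exp (real s) = (\<Sum>m<s. real s ^ m / fact m) + exp t / fact s * real s ^ s"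
    using Maclaurin_exp_le[of "real s" s] by blast
  have "measure_pmf.prob (pois (2 * real s)) {..<s}
      = (\<Sum>m<s. 2 ^ m * (real s ^ m / fact m)) * exp (- (2 * real s))"
    by (simp add: measure_measure_pmf_finite pmf_pois sum_distrib_right power_mult_distrib)
  also have "\<dots> \<le> (\<Sum>m<s. 2 ^ s * (real s ^ m / fact m)) * exp (- (2 * real s))"
    by (intro mult_right_mono sum_mono power_increasing) auto
  also have "\<dots> = 2 ^ s * (\<Sum>m<s. real s ^ m / fact m) * exp (- (2 * real s))"
    by (simp add: sum_distrib_left)
  also have "\<dots> \<le> 2 ^ s * exp (real s) * exp (- (2 * real s))"
    by (intro mult_right_mono mult_left_mono) (simp_all add: t)
  also have "\<dots> = (2 / exp 1) ^ s"
    by (simp add: power_divide exp_of_nat_mult[symmetric] exp_minus divide_simps flip: exp_add)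
  finally show ?thesis .
qed

section \<open>Occurrence patterns as triples of independent Poisson counts\<close>

fun pois3 :: "real \<times> real \<times> real \<Rightarrow> (nat \<times> nat \<times> nat) pmf" where
  "pois3 (a, b, t) = pair_pmf (pois a) (pair_pmf (pois b) (pois t))"

fun total :: "nat \<times> nat \<times> nat \<Rightarrow> nat" where
  "total (i, j, k) = i + j + k"

lemma exp_diff_diff: "exp (- a - b - t) = exp (- a) * (exp (- b) * exp (- t))" for a b t :: real
  by (simp flip: exp_add)

lemma pmf_pois3:
  "a \<ge> 0 \<Longrightarrow> b \<ge> 0 \<Longrightarrow> t \<ge> 0 \<Longrightarrow> pmf (pois3 (a, b, t)) (i, j, k)
    = a ^ i / fact i * (b ^ j / fact j) * (t ^ k / fact k) * exp (- (a + b + t))"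
  by (simp add: pmf_pair pmf_pois exp_diff_diff diff_diff_add[symmetric] ac_simps)

lemma map_pmf_pair_componentwise:
  "map_pmf (\<lambda>((a, b), (a', b')). (f a a', g b b')) (pair_pmf (pair_pmf A B) (pair_pmf A' B'))
   = pair_pmf (map_pmf (\<lambda>(a, a'). f a a') (pair_pmf A A')) (map_pmf (\<lambda>(b, b'). g b b') (pair_pmf B B'))"
  by (simp add: pair_pmf_def map_pmf_def bind_assoc_pmf bind_return_pmf)
     (subst bind_commute_pmf[of B A'], rule refl)

lemma pois3_add:
  assumes "a \<ge> 0" "b \<ge> 0" "t \<ge> 0" "a' \<ge> 0" "b' \<ge> 0" "t' \<ge> 0"
  shows "map_pmf (\<lambda>(u, v). u + v) (pair_pmf (pois3 (a, b, t)) (pois3 (a', b', t')))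
       = pois3 (a + a', b + b', t + t')"
proof -
  have "map_pmf (\<lambda>(u, v). u + v) (pair_pmf (pois3 (a, b, t)) (pois3 (a', b', t')))
    = map_pmf (\<lambda>((i, u), (i', v)). (i + i', u + v)) (pair_pmf (pois3 (a, b, t)) (pois3 (a', b', t')))"
    by (intro map_pmf_cong) auto
  also have "\<dots> = pair_pmf (pois (a + a')) (map_pmf (\<lambda>(u, v). u + v)
      (pair_pmf (pair_pmf (pois b) (pois t)) (pair_pmf (pois b') (pois t'))))"
    using assms by (simp add: map_pmf_pair_componentwise pois_add)
  also have "map_pmf (\<lambda>(u, v). u + v)
      (pair_pmf (pair_pmf (pois b) (pois t)) (pair_pmf (pois b') (pois t')))
    = map_pmf (\<lambda>((i, u), (i', v)). (i + i', u + v))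
      (pair_pmf (pair_pmf (pois b) (pois t)) (pair_pmf (pois b') (pois t')))"
    by (intro map_pmf_cong) auto
  also have "\<dots> = pair_pmf (pois (b + b')) (pois (t + t'))"
    using assms by (simp add: map_pmf_pair_componentwise pois_add)
  finally show ?thesis by simp
qed

text \<open>Superposition of Poisson variables: once collisions are split, a set of elements matters
  only through its three total rates.\<close>

lemma pois3_sum_Pi:
  assumes "finite I" "\<And>x. x \<in> I \<Longrightarrow> a x \<ge> 0 \<and> b x \<ge> 0 \<and> t x \<ge> 0"
  shows "map_pmf (\<lambda>c. \<Sum>x\<in>I. c x) (Pi_pmf I 0 (\<lambda>x. pois3 (a x, b x, t x)))
       = pois3 (\<Sum>x\<in>I. a x, \<Sum>x\<in>I. b x, \<Sum>x\<in>I. t x)"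
  using assms
proof (induction I rule: finite_induct)
  case empty
  show ?case by (simp add: pois_def pair_pmf_def bind_return_pmf zero_prod_def)
next
  case (insert x I)
  have upd: "(\<Sum>y\<in>I. if y = x then v else c y) = (\<Sum>y\<in>I. c y)" for c :: "_ \<Rightarrow> nat \<times> nat \<times> nat" and v
    using insert by (intro sum.cong) auto
  have "map_pmf (\<lambda>c. \<Sum>y\<in>insert x I. c y) (Pi_pmf (insert x I) 0 (\<lambda>x. pois3 (a x, b x, t x)))
      = map_pmf (\<lambda>(u, v). u + v) (map_pmf (\<lambda>(u, c). (u, \<Sum>y\<in>I. c y))
          (pair_pmf (pois3 (a x, b x, t x)) (Pi_pmf I 0 (\<lambda>x. pois3 (a x, b x, t x)))))"
    using insert.hyps by (subst Pi_pmf_insert)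
      (auto simp: pmf.map_comp o_def case_prod_unfold upd fun_upd_def simp del: pois3.simps intro!: map_pmf_cong)
  also have "map_pmf (\<lambda>(u, c). (u, \<Sum>y\<in>I. c y))
          (pair_pmf (pois3 (a x, b x, t x)) (Pi_pmf I 0 (\<lambda>x. pois3 (a x, b x, t x))))
      = pair_pmf (pois3 (a x, b x, t x)) (map_pmf (\<lambda>c. \<Sum>y\<in>I. c y) (Pi_pmf I 0 (\<lambda>x. pois3 (a x, b x, t x))))"
    by (simp add: pair_map_pmf2 apsnd_def map_prod_def)
  also have "\<dots> = pair_pmf (pois3 (a x, b x, t x)) (pois3 (\<Sum>x\<in>I. a x, \<Sum>x\<in>I. b x, \<Sum>x\<in>I. t x))"
    using insert by auto
  finally show ?case
    using insert by (subst (asm) pois3_add) (auto intro!: sum_nonneg)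
qed

text \<open>Reduces the probability of a collision to a one-dimensional Poisson tail.\<close>

lemma map_total_pois3:
  assumes "a \<ge> 0" "b \<ge> 0" "t \<ge> 0"
  shows "map_pmf total (pois3 (a, b, t)) = pois (a + b + t)"
proof -
  have "map_pmf total (pois3 (a, b, t))
      = map_pmf (\<lambda>(i, j). i + j) (pair_pmf (pois a) (map_pmf (\<lambda>(i, j). i + j) (pair_pmf (pois b) (pois t))))"
    by (simp add: pair_map_pmf2 pmf.map_comp o_def case_prod_unfold)
       (intro map_pmf_cong, auto)
  then show ?thesis using assms by (simp add: pois_add add.assoc)
qed

section \<open>Poissonized sampling\<close>

definition mset_of_counts :: "'a set \<Rightarrow> ('a \<Rightarrow> nat) \<Rightarrow> 'a multiset" where
  "mset_of_counts I f = (\<Sum>x\<in>I. replicate_mset (f x) x)"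

definition shuffle :: "'a set \<Rightarrow> ('a \<Rightarrow> nat) \<Rightarrow> 'a list pmf" where
  "shuffle I f = pmf_of_set (permutations_of_multiset (mset_of_counts I f))"

definition pois_sample :: "real \<Rightarrow> 'a pmf \<Rightarrow> 'a list pmf" where
  "pois_sample \<Lambda> X = bind_pmf (pois \<Lambda>) (\<lambda>N. replicate_pmf N X)"

lemma count_mset_of_counts:
  "finite I \<Longrightarrow> count (mset_of_counts I f) y = (if y \<in> I then f y else 0)"
  by (simp add: mset_of_counts_def count_sum sum.delta)

lemma pmf_replicate_pmf:
  "pmf (replicate_pmf N X) xs = (if length xs = N then prod_list (map (pmf X) xs) else 0)"
proof (induction N arbitrary: xs)
  case 0
  show ?case by (auto simp: indicator_def)
next
  case (Suc N)
  show ?case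
  proof (cases xs)
    case Nil
    then show ?thesis by (auto simp: pmf_eq_0_set_pmf set_replicate_pmf)
  next
    case (Cons x ys)
    have "replicate_pmf (Suc N) X = map_pmf (\<lambda>(x, xs). x # xs) (pair_pmf X (replicate_pmf N X))"
      by (simp add: pair_pmf_def map_pmf_def bind_assoc_pmf bind_return_pmf)
    then have "pmf (replicate_pmf (Suc N) X) xs
      = pmf (map_pmf (\<lambda>(x, xs). x # xs) (pair_pmf X (replicate_pmf N X))) ((\<lambda>(x, xs). x # xs) (x, ys))"
      by (simp add: Cons)
    also have "\<dots> = pmf (pair_pmf X (replicate_pmf N X)) (x, ys)"
      by (rule pmf_map_inj') (auto simp: inj_on_def)
    finally show ?thesis by (simp add: pmf_pair Suc Cons)
  qed
qed

lemma prod_list_eq_prod_count: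
  fixes g :: "'a \<Rightarrow> real"
  shows "finite I \<Longrightarrow> set xs \<subseteq> I \<Longrightarrow> prod_list (map g xs) = (\<Prod>x\<in>I. g x ^ count (mset xs) x)"
proof (induction xs)
  case (Cons y xs)
  have "(\<Prod>x\<in>I. g x ^ count (mset (y # xs)) x)
      = (\<Prod>x\<in>I. (if x = y then g x else 1) * g x ^ count (mset xs) x)"
    by (intro prod.cong) auto
  also have "\<dots> = g y * (\<Prod>x\<in>I. g x ^ count (mset xs) x)"
    using Cons.prems by (simp add: prod.distrib prod.delta)
  finally show ?case using Cons by simp
qed simp

text \<open>Poissonization: a Poisson number of independent draws has independent Poisson counts,
  and given the counts every ordering is equally likely. The two mass functions are compared at each
  list.\<close>

lemma pois_sample_eq_shuffle:
  assumes fin: "finite I" and supp: "set_pmf X \<subseteq> I" and \<Lambda>: "\<Lambda> \<ge> 0"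
  shows "pois_sample \<Lambda> X = bind_pmf (Pi_pmf I 0 (\<lambda>x. pois (\<Lambda> * pmf X x))) (shuffle I)"
proof (rule pmf_eqI)
  fix xs
  define M where "M = Pi_pmf I 0 (\<lambda>x. pois (\<Lambda> * pmf X x))"
  have sum1: "(\<Sum>x\<in>I. pmf X x) = 1" using sum_pmf_eq_1[OF fin supp] .
  have "pmf (pois_sample \<Lambda> X) xs
      = expect (pois \<Lambda>) (\<lambda>N. of_bool (N = length xs) * prod_list (map (pmf X) xs))"
    unfolding pois_sample_def pmf_bind by (intro expect_cong) (auto simp: pmf_replicate_pmf)
  also have "\<dots> = pmf (pois \<Lambda>) (length xs) * prod_list (map (pmf X) xs)"
    by (rule expect_indicator_mult)
  finally have L: "pmf (pois_sample \<Lambda> X) xs = \<dots>" .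
  have pmf_sh: "pmf (shuffle I f) xs
      = of_bool (mset_of_counts I f = mset xs) / card (permutations_of_multiset (mset xs))" for f
  proof -
    have "xs \<in> permutations_of_multiset (mset_of_counts I f) \<longleftrightarrow> mset_of_counts I f = mset xs"
      by (auto simp: permutations_of_multiset_def)
    then show ?thesis
      unfolding shuffle_def by (subst pmf_of_set) (auto simp: indicator_def)
  qed
  show "pmf (pois_sample \<Lambda> X) xs = pmf (bind_pmf M (shuffle I)) xs"
  proof (cases "set xs \<subseteq> I")
    case False
    then obtain x where x: "x \<in> set xs" "x \<notin> I" by auto
    then have "prod_list (map (pmf X) xs) = 0"
      using supp by (auto simp: prod_list_zero_iff set_pmf_iff image_iff intro!: bexI[of _ x])
    moreover have "mset_of_counts I f \<noteq> mset xs" for f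
    proof
      assume "mset_of_counts I f = mset xs"
      then have "count (mset xs) x = 0" using count_mset_of_counts[OF fin, of f x] x by simp
      with x show False by (simp add: count_eq_zero_iff)
    qed
    ultimately show ?thesis by (simp add: L pmf_bind pmf_sh)
  next
    case True
    define f0 where "f0 = count (mset xs)"
    have f00: "f0 x = 0" if "x \<notin> I" for x using that True by (auto simp: f0_def count_eq_zero_iff)
    \<comment> \<open>Only one count function vanishing off \<open>I\<close> can be shuffled into
      \<open>xs\<close>, so a single term of the mixture survives.\<close>
    have iff: "mset_of_counts I f = mset xs \<longleftrightarrow> f = f0" if "\<forall>x. x \<notin> I \<longrightarrow> f x = 0" for f
    proof -
      have "mset_of_counts I f = mset xs \<longleftrightarrow> (\<forall>x. (if x \<in> I then f x else 0) = f0 x)"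
        by (simp only: multiset_eq_iff count_mset_of_counts[OF fin] f0_def)
      also have "\<dots> \<longleftrightarrow> (\<forall>x. f x = f0 x)" using that f00 by metis
      also have "\<dots> \<longleftrightarrow> f = f0" by (simp add: fun_eq_iff)
      finally show ?thesis .
    qed
    have len: "length xs = (\<Sum>x\<in>I. f0 x)"
    proof -
      have "length xs = (\<Sum>x\<in>set xs. f0 x)"
        unfolding f0_def by (simp flip: size_mset add: size_multiset_overloaded_eq)
      also have "\<dots> = (\<Sum>x\<in>I. f0 x)"
        using fin True by (intro sum.mono_neutral_left) (auto simp: f0_def count_eq_zero_iff)
      finally show ?thesis .
    qed
    define K where "K = real (card (permutations_of_multiset (mset xs)))"
    have "f0 x = 0" if "x \<notin> set xs" for x using that by (simp add: f0_def count_eq_zero_iff)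
    then have "(\<Prod>x\<in>set xs. fact (f0 x)) = (\<Prod>x\<in>I. fact (f0 x) :: nat)"
      using fin True by (intro prod.mono_neutral_left) auto
    \<comment> \<open>The number of orderings is a multinomial coefficient; it trades the factorials
      of the single counts for the factorial of the length.\<close>
    then have "card (permutations_of_multiset (mset xs)) * (\<Prod>x\<in>I. fact (f0 x)) = (fact (length xs) :: nat)"
      using card_permutations_of_multiset_aux[of "mset xs"] by (simp add: f0_def)
    from arg_cong[OF this, of real] have Kf: "K * (\<Prod>x\<in>I. fact (f0 x)) = fact (length xs)"
      by (simp add: K_def)
    then have K0: "K \<noteq> 0" by (metis fact_nonzero mult_zero_left)
    have "pmf (bind_pmf M (shuffle I)) xs = expect M (\<lambda>f. of_bool (f = f0) * (1 / K))"
      unfolding pmf_bind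
    proof (rule expect_cong)
      fix f assume "f \<in> set_pmf M"
      then have "\<forall>x. x \<notin> I \<longrightarrow> f x = 0" using set_Pi_pmf_subset[OF fin, of 0 "\<lambda>x. pois (\<Lambda> * pmf X x)"] by (auto simp: M_def)
      then show "pmf (shuffle I f) xs = of_bool (f = f0) * (1 / K)"
        by (simp add: pmf_sh iff K_def)
    qed
    also have "\<dots> = pmf M f0 / K" by (subst expect_indicator_mult) simp
    also have "pmf M f0 = (\<Prod>x\<in>I. \<Lambda> ^ f0 x * pmf X x ^ f0 x / fact (f0 x) * exp (- (\<Lambda> * pmf X x)))"
      unfolding M_def using f00 \<Lambda> by (subst pmf_Pi'[OF fin]) (auto simp: pmf_pois power_mult_distrib)
    also have "\<dots> = \<Lambda> ^ length xs * prod_list (map (pmf X) xs) / (\<Prod>x\<in>I. fact (f0 x)) * exp (- \<Lambda>)"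
    proof -
      have "(\<Prod>x\<in>I. exp (- (\<Lambda> * pmf X x))) = exp (- \<Lambda>)"
      proof -
        have "(\<Sum>x\<in>I. - (\<Lambda> * pmf X x)) = - (\<Lambda> * (\<Sum>x\<in>I. pmf X x))"
          by (simp add: sum_negf sum_distrib_left)
        then show ?thesis using fin sum1 by (simp flip: exp_sum)
      qed
      then show ?thesis
        by (simp add: prod.distrib prod_dividef len power_sum prod_list_eq_prod_count[OF fin True] f0_def)
    qed
    also have "\<dots> / K = pmf (pois \<Lambda>) (length xs) * prod_list (map (pmf X) xs)"
      using K0 \<Lambda> unfolding pmf_pois[OF \<Lambda>] Kf[symmetric] by (simp add: field_simps)
    finally show ?thesis by (simp add: L)
  qed
qed

section \<open>Pairing and permuting the coordinates of a product distribution\<close>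

lemma Pi_pmf_pair:
  assumes "finite I"
  shows "Pi_pmf I (u, v) (\<lambda>x. pair_pmf (p x) (q x))
    = map_pmf (\<lambda>(f, g) x. (f x, g x)) (pair_pmf (Pi_pmf I u p) (Pi_pmf I v q))"
proof (rule pmf_eqI)
  fix h :: "'a \<Rightarrow> 'b \<times> 'c"
  define f g where "f = fst \<circ> h" and "g = snd \<circ> h"
  have h: "h = (\<lambda>(f, g) x. (f x, g x)) (f, g)" by (auto simp: f_def g_def)
  have "pmf (map_pmf (\<lambda>(f, g) x. (f x, g x)) (pair_pmf (Pi_pmf I u p) (Pi_pmf I v q))) h
      = pmf (pair_pmf (Pi_pmf I u p) (Pi_pmf I v q)) (f, g)"
    unfolding h by (rule pmf_map_inj') (auto simp: inj_def fun_eq_iff)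
  also have "\<dots> = pmf (Pi_pmf I (u, v) (\<lambda>x. pair_pmf (p x) (q x))) h"
    unfolding pmf_pair h using assms by (auto simp: pmf_Pi pmf_pair prod.distrib)
  finally show "pmf (Pi_pmf I (u, v) (\<lambda>x. pair_pmf (p x) (q x))) h
    = pmf (map_pmf (\<lambda>(f, g) x. (f x, g x)) (pair_pmf (Pi_pmf I u p) (Pi_pmf I v q))) h" ..
qed

lemma Pi_pmf_permute:
  fixes p :: "'a \<Rightarrow> 'b pmf"
  assumes "finite I" "\<pi> permutes I"
  shows "map_pmf (\<lambda>c. c \<circ> \<pi>) (Pi_pmf I z p) = Pi_pmf I z (p \<circ> \<pi>)"
proof (rule pmf_eqI)
  fix h :: "'a \<Rightarrow> 'b"
  have s: "surj \<pi>" and b: "bij_betw \<pi> I I"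
    using assms(2) by (auto simp: permutes_surj permutes_imp_bij)
  define k where "k = h \<circ> inv \<pi>"
  have h: "h = k \<circ> \<pi>" using assms(2) by (auto simp: k_def fun_eq_iff permutes_inverses)
  have "pmf (map_pmf (\<lambda>c. c \<circ> \<pi>) (Pi_pmf I z p)) h = pmf (Pi_pmf I z p) k"
    unfolding h by (rule pmf_map_inj') (use s in \<open>auto simp: inj_def fun_eq_iff surj_def; metis\<close>)
  also have "\<dots> = pmf (Pi_pmf I z (p \<circ> \<pi>)) h"
  proof -
    have "(\<forall>x. x \<notin> I \<longrightarrow> k x = z) \<longleftrightarrow> (\<forall>x. x \<notin> I \<longrightarrow> h x = z)"
      unfolding h using assms(2) by (simp add: permutes_def) 
    moreover have "(\<Prod>x\<in>I. pmf (p x) (k x)) = (\<Prod>x\<in>I. pmf (p (\<pi> x)) (h x))"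
      using prod.reindex_bij_betw[OF b, of "\<lambda>x. pmf (p x) (k x)"] by (simp add: h)
    ultimately show ?thesis by (simp only: pmf_Pi[OF assms(1)] comp_apply)
  qed
  finally show "pmf (map_pmf (\<lambda>c. c \<circ> \<pi>) (Pi_pmf I z p)) h = pmf (Pi_pmf I z (p \<circ> \<pi>)) h" .
qed

section \<open>Splitting collisions into singletons\<close>

text \<open>Replaces an element with this pattern by distinct elements seen once each. Unlike
  \<open>single\<close> this is additive, so after splitting only the sum of all patterns is
  visible.\<close>

fun singles :: "nat \<times> nat \<times> nat \<Rightarrow> (nat \<times> nat \<times> nat) multiset" where
  "singles (i, j, k) = replicate_mset i (1, 0, 0) + replicate_mset j (0, 1, 0) + replicate_mset k (0, 0, 1)"

lemma replicate_mset_add: "replicate_mset (m + n) x = replicate_mset m x + replicate_mset n x"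
  by (induction m) auto

lemma singles_add: "singles (u + v) = singles u + singles v"
  by (cases u; cases v) (simp add: replicate_mset_add)

lemma singles_eq_single: "total u \<le> 1 \<Longrightarrow> singles u = single u"
proof (cases u)
  case (fields i j k)
  assume "total u \<le> 1"
  then consider "u = (0, 0, 0)" | "u = (1, 0, 0)" | "u = (0, 1, 0)" | "u = (0, 0, 1)"
    using fields by (cases i; cases j; cases k) auto
  then show ?thesis by cases (auto simp: single_def zero_prod_def)
qed

lemma singles_total_2:
  assumes "total u = 2"
  obtains a b where "singles u = {#a, b#}" "total a = 1" "total b = 1"
proof (cases u)
  case (fields i j k)
  then consider "u = (2, 0, 0)" | "u = (0, 2, 0)" | "u = (0, 0, 2)"
      | "u = (1, 1, 0)" | "u = (1, 0, 1)" | "u = (0, 1, 1)"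
    using assms by (cases i; cases j; cases k; cases "i - 1"; cases "j - 1"; cases "k - 1") auto
  then show ?thesis
    by cases (auto simp: numeral_2_eq_2 intro!: that)
qed

text \<open>
  A pattern of total 2 is traded for two singletons by three smooth shifts, each of size at most
  \<open>\<theta> / 3\<close>; larger patterns are given up, at cost at most \<open>\<theta> + 1\<close>.
\<close>

definition split_cost :: "real \<Rightarrow> nat \<times> nat \<times> nat \<Rightarrow> real" where
  "split_cost \<theta> u = \<theta> * of_bool (total u \<ge> 2) + of_bool (total u \<ge> 3)"

lemma split_pattern:
  fixes \<Phi> :: "(nat \<times> nat \<times> nat) multiset \<Rightarrow> real"
  assumes bd: "\<And>U. 0 \<le> \<Phi> U \<and> \<Phi> U \<le> 1"
    and step: "\<And>v U. total v \<in> {1, 2} \<Longrightarrow> 3 * \<bar>\<Phi> (U + {#v#}) - \<Phi> U\<bar> \<le> \<theta>"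
  shows "\<bar>\<Phi> (U + single u) - \<Phi> (U + singles u)\<bar> \<le> split_cost \<theta> u"
proof -
  have "0 \<le> 3 * \<bar>\<Phi> (U + {#(1, 0, 0)#}) - \<Phi> U\<bar>" by simp
  also have "\<dots> \<le> \<theta>" by (rule step) simp
  finally have \<theta>: "0 \<le> \<theta>" .
  consider "total u \<le> 1" | "total u = 2" | "total u \<ge> 3" by linarith
  then show ?thesis
  proof cases
    case 1
    then show ?thesis by (simp add: singles_eq_single split_cost_def)
  next
    case 2
    obtain a b where ab: "singles u = {#a, b#}" "total a = 1" "total b = 1"
      by (rule singles_total_2[OF 2])
    have "u \<noteq> 0" using 2 by (cases u) (auto simp: zero_prod_def)
    then have "single u = {#u#}" by (simp add: single_def)
    moreover have "\<bar>\<Phi> (U + {#u#}) - \<Phi> (U + {#a#} + {#b#})\<bar> \<le> \<theta>"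
      using step[of u U] step[of a U] step[of b "U + {#a#}"] 2 ab(2,3) by (simp add: abs_if split: if_splits)
    ultimately show ?thesis using 2 ab(1) by (simp add: split_cost_def add_mset_commute)
  next
    case 3
    then show ?thesis using bd[of "U + single u"] bd[of "U + singles u"] \<theta> by (auto simp: split_cost_def abs_if)
  qed
qed

text \<open>A hybrid argument: the elements are split one at a time, and the arbitrary context
  \<open>U\<close> holds those already split as well as those still to come.\<close>

lemma split_patterns:
  fixes \<Phi> :: "(nat \<times> nat \<times> nat) multiset \<Rightarrow> real"
  assumes "finite B"
    and "\<And>U u. \<bar>\<Phi> (U + single u) - \<Phi> (U + singles u)\<bar> \<le> split_cost \<theta> u"
  shows "\<bar>\<Phi> (U + nonzero_patterns B c) - \<Phi> (U + singles (\<Sum>x\<in>B. c x))\<bar>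
    \<le> (\<Sum>x\<in>B. split_cost \<theta> (c x))"
  using assms(1)
proof (induction B arbitrary: U rule: finite_induct)
  case empty
  show ?case by (simp add: nonzero_patterns_def zero_prod_def)
next
  case (insert x B)
  have 1: "\<bar>\<Phi> (U + nonzero_patterns B c + single (c x)) - \<Phi> (U + nonzero_patterns B c + singles (c x))\<bar>
      \<le> split_cost \<theta> (c x)"
    by (rule assms(2))
  have 2: "\<bar>\<Phi> (U + singles (c x) + nonzero_patterns B c)
      - \<Phi> (U + singles (c x) + singles (\<Sum>x\<in>B. c x))\<bar> \<le> (\<Sum>x\<in>B. split_cost \<theta> (c x))"
    by (rule insert.IH)
  have eqs: "U + nonzero_patterns (insert x B) c = U + nonzero_patterns B c + single (c x)"
    "U + nonzero_patterns B c + singles (c x) = U + singles (c x) + nonzero_patterns B c"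
    "U + singles (\<Sum>x\<in>insert x B. c x) = U + singles (c x) + singles (\<Sum>x\<in>B. c x)"
    using insert.hyps by (auto simp: nonzero_patterns_def singles_add ac_simps)
  show ?case
    unfolding eqs(1,3)
    using 1[unfolded eqs(2)] 2 sum.insert[OF insert.hyps, of "\<lambda>x. split_cost \<theta> (c x)"] by linarith
qed

lemma expect_split_cost:
  assumes "a \<ge> 0" "b \<ge> 0" "t \<ge> 0" "\<theta> \<ge> 0"
  shows "expect (pois3 (a, b, t)) (split_cost \<theta>) \<le> \<theta> * (a + b + t)\<^sup>2 / 2 + (a + b + t) ^ 3 / 6"
proof -
  define M where "M = pois (a + b + t)"
  have "expect (pois3 (a, b, t)) (split_cost \<theta>)
      = expect (map_pmf total (pois3 (a, b, t))) (\<lambda>N. \<theta> * of_bool (N \<ge> 2) + of_bool (N \<ge> 3))"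
    by (simp add: split_cost_def[abs_def] del: pois3.simps)
  also have "\<dots> = expect M (\<lambda>N. \<theta> * indicator {2..} N + indicator {3..} N)"
    using assms by (auto simp: map_total_pois3 M_def indicator_def intro!: expect_cong simp del: pois3.simps)
  also have "\<dots> = \<theta> * measure_pmf.prob M {2..} + measure_pmf.prob M {3..}"
  proof -
    have "integrable M (\<lambda>N. \<theta> * indicator {2..} N)"
      by (rule integrable_pmf_bounded[where B = \<theta>]) (use assms in \<open>auto simp: indicator_def\<close>)
    moreover have "integrable M (\<lambda>N. indicator {3..} N :: real)"
      by (rule integrable_pmf_bounded[where B = 1]) (auto simp: indicator_def)
    ultimately show ?thesis by simp
  qed
  also have "\<dots> \<le> \<theta> * ((a + b + t) ^ 2 / fact 2) + (a + b + t) ^ 3 / fact 3"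
    unfolding M_def using assms by (intro add_mono mult_left_mono pois_upper_tail) auto
  finally show ?thesis by (simp add: fact_numeral)
qed

lemma expect_Pi_union:
  fixes F :: "('a \<Rightarrow> 'b) \<Rightarrow> real"
  assumes "finite A" "finite B" "A \<inter> B = {}" "\<And>c. \<bar>F c\<bar> \<le> K"
  shows "expect (Pi_pmf (A \<union> B) z p) F
    = expect (Pi_pmf A z p) (\<lambda>f. expect (Pi_pmf B z p) (\<lambda>g. F (\<lambda>x. if x \<in> A then f x else g x)))"
  using assms by (simp add: Pi_pmf_union expect_pair[where B = K])

text \<open>The elements of \<open>D\<close> are integrated out first, which turns \<open>G\<close>
  into the smooth function \<open>\<Phi>\<close>. For each fixed outcome on \<open>B\<close> the
  patterns are then split inside \<open>\<Phi>\<close>, and only the cost is averaged over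
  \<open>B\<close>. The counts on \<open>B\<close> and on \<open>D\<close> are independent, so
  fixing the one does not disturb the noise of the other.\<close>

lemma poissonized_vs_singles:
  fixes G :: "(nat \<times> nat \<times> nat) multiset \<Rightarrow> real"
  assumes fin: "finite D" "finite B" "D \<inter> B = {}"
    and rates: "\<And>x. x \<in> B \<Longrightarrow> a x \<ge> 0 \<and> b x \<ge> 0 \<and> t x \<ge> 0"
    and G: "\<And>U. 0 \<le> G U \<and> G U \<le> 1"
    and q: "q = (\<lambda>x. pois3 (a x, b x, t x))"
    and \<Phi>: "\<Phi> = (\<lambda>U. expect (Pi_pmf D 0 q) (\<lambda>c. G (nonzero_patterns D c + U)))"
    and step: "\<And>v U. total v \<in> {1, 2} \<Longrightarrow> 3 * \<bar>\<Phi> (U + {#v#}) - \<Phi> U\<bar> \<le> \<theta>"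
  shows "\<bar>expect (Pi_pmf (B \<union> D) 0 q) (\<lambda>c. G (nonzero_patterns (B \<union> D) c))
        - expect (pois3 (\<Sum>x\<in>B. a x, \<Sum>x\<in>B. b x, \<Sum>x\<in>B. t x)) (\<lambda>v. \<Phi> (singles v))\<bar>
      \<le> (\<Sum>x\<in>B. \<theta> * (a x + b x + t x)\<^sup>2 / 2 + (a x + b x + t x) ^ 3 / 6)"
proof -
  have G1: "\<bar>G U\<bar> \<le> 1" for U using G[of U] by simp
  have \<Phi>bd: "0 \<le> \<Phi> U \<and> \<Phi> U \<le> 1" for U
    using G abs_expect_le[OF G1] unfolding \<Phi> by (auto intro!: Bochner_Integration.integral_nonneg dest: abs_le_D1)
  have \<Phi>1: "\<bar>\<Phi> U\<bar> \<le> 1" for U using \<Phi>bd[of U] by simp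
  have "0 \<le> 3 * \<bar>\<Phi> ({#} + {#(1, 0, 0)#}) - \<Phi> {#}\<bar>" by simp
  also have "\<dots> \<le> \<theta>" by (rule step) simp
  finally have \<theta>: "0 \<le> \<theta>" .
  have cost: "\<bar>split_cost \<theta> u\<bar> \<le> \<theta> + 1" for u using \<theta> by (simp add: split_cost_def)
  define M where "M = Pi_pmf B 0 q"
  have comb: "nonzero_patterns (B \<union> D) (\<lambda>x. if x \<in> B then f x else g x)
      = nonzero_patterns D g + nonzero_patterns B f" for f g :: "'a \<Rightarrow> nat \<times> nat \<times> nat"
  proof -
    have "(\<Sum>d\<in>D. single (if d \<in> B then f d else g d)) = (\<Sum>d\<in>D. single (g d))"
      using fin(3) by (intro sum.cong) auto
    moreover have "B \<inter> D = {}" using fin(3) by auto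
    ultimately show ?thesis using fin by (simp add: nonzero_patterns_def sum.union_disjoint ac_simps)
  qed
  have 1: "expect (Pi_pmf (B \<union> D) 0 q) (\<lambda>c. G (nonzero_patterns (B \<union> D) c))
      = expect M (\<lambda>f. \<Phi> (nonzero_patterns B f))"
    unfolding M_def by (subst expect_Pi_union[where K = 1]) (use fin G1 in \<open>auto simp: comb \<Phi>\<close>)
  have 2: "expect (pois3 (\<Sum>x\<in>B. a x, \<Sum>x\<in>B. b x, \<Sum>x\<in>B. t x)) (\<lambda>v. \<Phi> (singles v))
      = expect M (\<lambda>f. \<Phi> (singles (\<Sum>x\<in>B. f x)))"
    unfolding M_def q by (subst pois3_sum_Pi[symmetric]) (use fin rates in auto)
  have "\<bar>expect M (\<lambda>f. \<Phi> (nonzero_patterns B f)) - expect M (\<lambda>f. \<Phi> (singles (\<Sum>x\<in>B. f x)))\<bar>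
      = \<bar>expect M (\<lambda>f. \<Phi> (nonzero_patterns B f) - \<Phi> (singles (\<Sum>x\<in>B. f x)))\<bar>"
    by (subst Bochner_Integration.integral_diff) (auto intro!: integrable_pmf_bounded \<Phi>1)
  also have "\<dots> \<le> expect M (\<lambda>f. \<bar>\<Phi> (nonzero_patterns B f) - \<Phi> (singles (\<Sum>x\<in>B. f x))\<bar>)"
    by (rule integral_abs_bound)
  also have "\<dots> \<le> expect M (\<lambda>f. \<Sum>x\<in>B. split_cost \<theta> (f x))"
  proof (rule expect_mono_bounded)
    show "\<bar>\<bar>\<Phi> (nonzero_patterns B f) - \<Phi> (singles (\<Sum>x\<in>B. f x))\<bar>\<bar> \<le> 1" for f
      using \<Phi>bd[of "nonzero_patterns B f"] \<Phi>bd[of "singles (\<Sum>x\<in>B. f x)"] by auto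
    show "\<bar>\<Sum>x\<in>B. split_cost \<theta> (f x)\<bar> \<le> card B * (\<theta> + 1)" for f
      by (rule order_trans[OF sum_abs]) (rule sum_bounded_above, rule cost)
    show "\<bar>\<Phi> (nonzero_patterns B f) - \<Phi> (singles (\<Sum>x\<in>B. f x))\<bar> \<le> (\<Sum>x\<in>B. split_cost \<theta> (f x))" for f
      using split_patterns[OF fin(2) split_pattern[OF \<Phi>bd step], of "{#}"] by simp
  qed
  also have "\<dots> = (\<Sum>x\<in>B. expect (q x) (split_cost \<theta>))"
  proof -
    have "expect M (\<lambda>f. \<Sum>x\<in>B. split_cost \<theta> (f x)) = (\<Sum>x\<in>B. expect M (\<lambda>f. split_cost \<theta> (f x)))"
      by (rule Bochner_Integration.integral_sum) (rule integrable_pmf_bounded, rule cost)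
    moreover have "expect M (\<lambda>f. split_cost \<theta> (f x)) = expect (q x) (split_cost \<theta>)" if "x \<in> B" for x
      using that fin(2) integral_map_pmf[of "\<lambda>f. f x" M "split_cost \<theta>"]
      by (simp add: M_def Pi_pmf_component)
    ultimately show ?thesis by simp
  qed
  also have "\<dots> \<le> (\<Sum>x\<in>B. \<theta> * (a x + b x + t x)\<^sup>2 / 2 + (a x + b x + t x) ^ 3 / 6)"
    unfolding q using rates \<theta> by (intro sum_mono expect_split_cost) auto
  finally show ?thesis unfolding 1 2 .
qed

text \<open>Stein's exchange with \<open>R = 4\<close>: rates at most 2 give
  \<open>l d ^ total v \<le> 4\<close>, and the factorials are at least 1. The remaining task is to
  bound the expected number \<open>m\<close> of occurrences of \<open>v\<close> from below by a
  multiple of \<open>S\<close>.\<close>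

lemma pois3_shift:
  fixes G :: "(nat \<times> nat \<times> nat) multiset \<Rightarrow> real"
  assumes fin: "finite D" and l: "\<And>d. d \<in> D \<Longrightarrow> 0 \<le> l d \<and> l d \<le> 2"
    and G: "\<And>U. \<bar>G U\<bar> \<le> 1" and S: "S = (\<Sum>d\<in>D. (l d)\<^sup>2)" "S > 0"
    and v: "total v \<in> {1, 2}"
    and \<mu>: "\<mu> = Pi_pmf D 0 (\<lambda>d. pois3 (l d, l d, l d))"
  shows "\<bar>expect \<mu> (\<lambda>c. G (nonzero_patterns D c + (U + {#v#})))
       - expect \<mu> (\<lambda>c. G (nonzero_patterns D c + U))\<bar> \<le> 6 * exp 3 / sqrt S"
proof -
  obtain i j k where ijk: "v = (i, j, k)" by (cases v) auto
  define m where "m = (\<Sum>d\<in>D. pmf (pois3 (l d, l d, l d)) v)"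
  have pv: "pmf (pois3 (l d, l d, l d)) v
      = l d ^ total v / (fact i * fact j * fact k) * exp (- (3 * l d))" if "d \<in> D" for d
    using l[OF that] by (simp add: ijk pmf_pois3 power_add field_simps del: pois3.simps)
  have p0: "pmf (pois3 (l d, l d, l d)) 0 = exp (- (3 * l d))" if "d \<in> D" for d
    using l[OF that] by (simp add: zero_prod_def pmf_pois3 del: pois3.simps)
  have f: "1 \<le> fact i * fact j * (fact k :: real)" "fact i * fact j * (fact k :: real) \<le> 2"
  proof -
    have "(i, j, k) \<in> {(1,0,0),(0,1,0),(0,0,1),(2,0,0),(0,2,0),(0,0,2),(1,1,0),(1,0,1),(0,1,1)}"
      using v unfolding ijk by (cases i; cases j; cases k; cases "i - 1"; cases "j - 1"; cases "k - 1") auto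
    then show "1 \<le> fact i * fact j * (fact k :: real)" "fact i * fact j * (fact k :: real) \<le> 2" by auto
  qed
  have up: "l d ^ total v \<le> 4" if "d \<in> D" for d
  proof -
    have "l d ^ total v \<le> 2 ^ total v" using l[OF that] by (intro power_mono) auto
    also have "\<dots> \<le> 4" using v by auto
    finally show ?thesis .
  qed
  \<comment> \<open>For total 1 this uses \<open>l d \<le> 2\<close>: up to a constant, patterns of
    total 2 are the rarest.\<close>
  have low: "(l d)\<^sup>2 / 2 \<le> l d ^ total v" if "d \<in> D" for d
    using v l[OF that] mult_left_mono[of "l d" 2 "l d"] by (auto simp: power2_eq_square)
  \<comment> \<open>One factor 1/2 comes from \<open>low\<close>, the other from the factorials, and
    \<open>exp (- 6)\<close> from rates at most 2 in three phases.\<close>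
  have "S / (2 * exp 6) / 2 \<le> m"
    unfolding m_def S sum_divide_distrib
  proof (intro sum_mono)
    fix d assume d: "d \<in> D"
    have "(l d)\<^sup>2 / (2 * exp 6) / 2 = ((l d)\<^sup>2 / 2) / 2 * exp (- 6)" by (simp add: exp_minus field_simps)
    also have "\<dots> \<le> l d ^ total v / (fact i * fact j * fact k) * exp (- (3 * l d))"
      using f low[OF d] l[OF d] by (intro mult_mono frac_le) auto
    finally show "(l d)\<^sup>2 / (2 * exp 6) / 2 \<le> pmf (pois3 (l d, l d, l d)) v" by (simp only: pv[OF d])
  qed
  then have m: "S / (4 * exp 6) \<le> m" by simp
  moreover have "S / (4 * exp 6) > 0" using S by simp
  ultimately have m0: "m > 0" by linarith
  have "v \<noteq> 0" using v by (auto simp: zero_prod_def)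
  have "\<bar>expect \<mu> (\<lambda>c. G (nonzero_patterns D c + {#v#} + U))
       - expect \<mu> (\<lambda>c. G (nonzero_patterns D c + U))\<bar> \<le> (1 + sqrt 4) / sqrt m"
    unfolding \<mu>
  proof (rule nonzero_patterns_shift[OF fin \<open>v \<noteq> 0\<close>, where G = "\<lambda>W. G (W + U)"])
    show "pmf (pois3 (l d, l d, l d)) v \<le> 4 * pmf (pois3 (l d, l d, l d)) 0" if d: "d \<in> D" for d
    proof -
      have "l d ^ total v / (fact i * fact j * fact k) \<le> 4 / 1"
        using f up[OF d] l[OF d] by (intro frac_le) auto
      then show ?thesis unfolding pv[OF d] p0[OF d] by (intro mult_right_mono) auto
    qed
  qed (use G p0 m_def m0 in \<open>auto simp del: pois3.simps\<close>)
  also have "\<dots> \<le> 3 / sqrt (S / (4 * exp 6))"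
    using m S by (intro frac_le) auto
  also have "\<dots> = 6 * exp 3 / sqrt S"
  proof -
    have "(4 :: real) * exp 6 = (2 * exp 3)\<^sup>2" by (simp add: power2_eq_square flip: exp_add)
    then show ?thesis by (simp only: real_sqrt_divide real_sqrt_abs) simp
  qed
  finally show ?thesis by (simp add: ac_simps)
qed

section \<open>Symmetrization over relabellings\<close>

lemma image_mset_eq_nonzero_patterns:
  "finite I \<Longrightarrow> \<exists>k. image_mset c (mset_set I) = nonzero_patterns I c + replicate_mset k 0"
proof (induction I rule: finite_induct)
  case empty
  show ?case by (intro exI[of _ 0]) (simp add: nonzero_patterns_def)
next
  case (insert x I)
  then obtain k where k: "image_mset c (mset_set I) = nonzero_patterns I c + replicate_mset k 0" by blast
  have np: "nonzero_patterns (insert x I) c = single (c x) + nonzero_patterns I c"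
    using insert.hyps by (simp add: nonzero_patterns_def)
  show ?case
    using insert.hyps k
    by (intro exI[of _ "if c x = 0 then Suc k else k"]) (simp add: np single_def)
qed

text \<open>The dropped zeros can be recovered: their number is the size of \<open>I\<close> minus
  the size of the multiset. Hence the full multisets of values agree as well, and such functions
  differ by a permutation of \<open>I\<close>.\<close>

lemma nonzero_patterns_eq_imp_permuted:
  assumes "finite I" "nonzero_patterns I c = nonzero_patterns I c'"
    and off: "\<forall>x. x \<notin> I \<longrightarrow> c x = 0" "\<forall>x. x \<notin> I \<longrightarrow> c' x = 0"
  obtains \<sigma> where "\<sigma> permutes I" "c = c' \<circ> \<sigma>"
proof -
  obtain k where k: "image_mset c (mset_set I) = nonzero_patterns I c + replicate_mset k 0"
    using image_mset_eq_nonzero_patterns[OF assms(1)] by blast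
  obtain l where l: "image_mset c' (mset_set I) = nonzero_patterns I c' + replicate_mset l 0"
    using image_mset_eq_nonzero_patterns[OF assms(1)] by blast
  have "size (nonzero_patterns I c) + k = size (nonzero_patterns I c') + l"
    using arg_cong[OF k, of size] arg_cong[OF l, of size] by simp
  then have "k = l" using assms(2) by simp
  then have "image_mset c (mset_set I) = image_mset c' (mset_set I)"
    using k l assms(2) by simp
  then obtain \<sigma> where \<sigma>: "\<sigma> permutes I" "\<forall>x\<in>I. c x = c' (\<sigma> x)"
    using image_mset_eq_implies_permutes[OF assms(1)] by blast
  have "c = c' \<circ> \<sigma>"
  proof
    fix x show "c x = (c' \<circ> \<sigma>) x"
      using \<sigma> off permutes_not_in[OF \<sigma>(1)] by (cases "x \<in> I") auto
  qed
  with \<sigma>(1) show ?thesis by (rule that)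
qed

text \<open>The average of \<open>F\<close> over all permutations is invariant, so it factors
  through the multiset of nonzero patterns. \<open>G\<close> is chosen before \<open>p\<close>: the
  same test must serve both choices of \<open>T\<close>.\<close>

lemma symmetrize:
  fixes F :: "('a \<Rightarrow> 'b::zero) \<Rightarrow> real"
  assumes fin: "finite I" and F: "\<And>c. 0 \<le> F c \<and> F c \<le> 1"
  shows "\<exists>G :: 'b multiset \<Rightarrow> real. (\<forall>U. 0 \<le> G U \<and> G U \<le> 1)
    \<and> (\<forall>p. expect (Pi_pmf I 0 p) (\<lambda>c. G (nonzero_patterns I c))
          = (\<Sum>\<pi> | \<pi> permutes I. expect (Pi_pmf I 0 (p \<circ> \<pi>)) F) / card {\<pi>. \<pi> permutes I})"
proof -
  define S where "S = {\<pi>. \<pi> permutes I}"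
  define H where "H c = (\<Sum>\<pi>\<in>S. F (c \<circ> \<pi>)) / card S" for c
  have finS: "finite S" unfolding S_def by (rule finite_permutations[OF fin])
  have "id \<in> S" by (simp add: S_def permutes_id)
  then have cS: "card S > 0" using finS card_gt_0_iff by blast
  have H: "0 \<le> H c \<and> H c \<le> 1" for c
  proof -
    have "(\<Sum>\<pi>\<in>S. F (c \<circ> \<pi>)) \<le> real (card S) * 1" by (rule sum_bounded_above) (use F in auto)
    then show ?thesis using F cS by (auto simp: H_def intro!: divide_nonneg_nonneg sum_nonneg)
  qed
  \<comment> \<open>Composition with \<open>\<sigma>\<close> only rearranges the summands of the
    average.\<close>
  have inv: "H (c \<circ> \<sigma>) = H c" if \<sigma>: "\<sigma> permutes I" for c \<sigma>
  proof -
    have "bij_betw (\<lambda>\<pi>. \<sigma> \<circ> \<pi>) S S"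
    proof (rule bij_betwI[where g = "\<lambda>\<pi>. inv \<sigma> \<circ> \<pi>"])
      show "(\<lambda>\<pi>. \<sigma> \<circ> \<pi>) \<in> S \<rightarrow> S" using \<sigma> by (auto simp: S_def permutes_compose)
      show "(\<lambda>\<pi>. inv \<sigma> \<circ> \<pi>) \<in> S \<rightarrow> S" using \<sigma> by (auto simp: S_def permutes_compose permutes_inv)
    qed (use permutes_inv_o[OF \<sigma>] in \<open>auto simp: o_assoc\<close>)
    from sum.reindex_bij_betw[OF this, of "\<lambda>\<pi>. F (c \<circ> \<pi>)"]
    show ?thesis by (simp add: H_def o_assoc)
  qed
  define Z where "Z = {c :: 'a \<Rightarrow> 'b. \<forall>x. x \<notin> I \<longrightarrow> c x = 0}"
  \<comment> \<open>Any representative in \<open>Z\<close> will do, by invariance; the default 0 for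
    multisets that do not occur keeps \<open>G\<close> within [0, 1].\<close>
  define G where "G U = (if \<exists>c\<in>Z. nonzero_patterns I c = U
      then H (SOME c. c \<in> Z \<and> nonzero_patterns I c = U) else 0)" for U
  have G: "G (nonzero_patterns I c) = H c" if c: "c \<in> Z" for c
  proof -
    define c' where "c' = (SOME c'. c' \<in> Z \<and> nonzero_patterns I c' = nonzero_patterns I c)"
    have c': "c' \<in> Z \<and> nonzero_patterns I c' = nonzero_patterns I c"
      unfolding c'_def by (rule someI[of _ c]) (use c in auto)
    then obtain \<sigma> where "\<sigma> permutes I" "c' = c \<circ> \<sigma>"
      using nonzero_patterns_eq_imp_permuted[OF fin, of c' c] c by (auto simp: Z_def)
    then have "H c' = H c" using inv by simp
    then show ?thesis using c unfolding G_def c'_def by auto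
  qed
  show ?thesis
  proof (intro exI[of _ G] conjI allI)
    show "0 \<le> G U" "G U \<le> 1" for U using H by (auto simp: G_def)
    fix p :: "'a \<Rightarrow> 'b pmf"
    have "expect (Pi_pmf I 0 p) (\<lambda>c. G (nonzero_patterns I c)) = expect (Pi_pmf I 0 p) H"
      by (intro expect_cong G) (use set_Pi_pmf_subset[OF fin, of 0 p] in \<open>auto simp: Z_def\<close>)
    also have "\<dots> = (\<Sum>\<pi>\<in>S. expect (Pi_pmf I 0 p) (\<lambda>c. F (c \<circ> \<pi>))) / card S"
      unfolding H_def using F
      by (subst Bochner_Integration.integral_sum[symmetric])
         (auto intro!: integrable_pmf_bounded[where B = 1])
    also have "(\<Sum>\<pi>\<in>S. expect (Pi_pmf I 0 p) (\<lambda>c. F (c \<circ> \<pi>)))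
        = (\<Sum>\<pi>\<in>S. expect (Pi_pmf I 0 (p \<circ> \<pi>)) F)"
    proof (intro sum.cong refl)
      fix \<pi> assume "\<pi> \<in> S"
      then have "\<pi> permutes I" by (simp add: S_def)
      from Pi_pmf_permute[OF fin this, of 0 p, symmetric]
      show "expect (Pi_pmf I 0 p) (\<lambda>c. F (c \<circ> \<pi>)) = expect (Pi_pmf I 0 (p \<circ> \<pi>)) F" by simp
    qed
    finally show "expect (Pi_pmf I 0 p) (\<lambda>c. G (nonzero_patterns I c))
      = (\<Sum>\<pi> | \<pi> permutes I. expect (Pi_pmf I 0 (p \<circ> \<pi>)) F) / card {\<pi>. \<pi> permutes I}"
      by (simp add: S_def)
  qed
qed

section \<open>Algorithms on Poissonized samples\<close>

text \<open>With too few samples the answer is \<open>First\<close>, so a shortage can only raise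
  the probability of \<open>First\<close>.\<close>

definition run_prefix :: "algorithm \<Rightarrow> nat \<Rightarrow> algorithm" where
  "run_prefix A s xs ys ts =
     (if s \<le> length xs \<and> s \<le> length ys \<and> s \<le> length ts
      then A (take s xs) (take s ys) (take s ts) else return_pmf First)"

text \<open>Given the counts, the order of a sample is pure noise and can be generated afresh; this
  makes the algorithm a randomized function of the patterns alone.\<close>

definition run_on_counts :: "nat set \<Rightarrow> algorithm \<Rightarrow> nat \<Rightarrow> (nat \<Rightarrow> nat \<times> nat \<times> nat) \<Rightarrow> answer pmf" where
  "run_on_counts I A s c =
     do { xs \<leftarrow> shuffle I (\<lambda>x. fst (c x));
          ys \<leftarrow> shuffle I (\<lambda>x. fst (snd (c x)));
          ts \<leftarrow> shuffle I (\<lambda>x. snd (snd (c x)));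
          run_prefix A s xs ys ts }"

definition counts_pmf :: "nat set \<Rightarrow> real \<Rightarrow> nat pmf \<Rightarrow> nat pmf \<Rightarrow> nat pmf \<Rightarrow> (nat \<Rightarrow> nat \<times> nat \<times> nat) pmf" where
  "counts_pmf I \<Lambda> X Y T = Pi_pmf I 0 (\<lambda>x. pois3 (\<Lambda> * pmf X x, \<Lambda> * pmf Y x, \<Lambda> * pmf T x))"

text \<open>Poissonization in each phase separately; the rest is commuting independent draws until
  every shuffle follows its own counts.\<close>

lemma bind_counts_pmf:
  assumes "finite I" "set_pmf X \<subseteq> I" "set_pmf Y \<subseteq> I" "set_pmf T \<subseteq> I" "\<Lambda> \<ge> 0"
  shows "bind_pmf (counts_pmf I \<Lambda> X Y T) (run_on_counts I A s) =
    do { xs \<leftarrow> pois_sample \<Lambda> X; ys \<leftarrow> pois_sample \<Lambda> Y; ts \<leftarrow> pois_sample \<Lambda> T; run_prefix A s xs ys ts }"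
proof -
  define PX where "PX = Pi_pmf I 0 (\<lambda>x. pois (\<Lambda> * pmf X x))"
  define PY where "PY = Pi_pmf I 0 (\<lambda>x. pois (\<Lambda> * pmf Y x))"
  define PT where "PT = Pi_pmf I 0 (\<lambda>x. pois (\<Lambda> * pmf T x))"
  have "bind_pmf (counts_pmf I \<Lambda> X Y T) (run_on_counts I A s) =
    do { f \<leftarrow> PX; g \<leftarrow> PY; h \<leftarrow> PT;
         xs \<leftarrow> shuffle I f; ys \<leftarrow> shuffle I g; ts \<leftarrow> shuffle I h; run_prefix A s xs ys ts }"
    unfolding counts_pmf_def pois3.simps zero_prod_def Pi_pmf_pair[OF assms(1)]
    by (simp add: pair_pmf_def map_pmf_def bind_assoc_pmf bind_return_pmf run_on_counts_def
        PX_def PY_def PT_def zero_prod_def)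
  also have "\<dots> =
    do { f \<leftarrow> PX; g \<leftarrow> PY; xs \<leftarrow> shuffle I f; ys \<leftarrow> shuffle I g;
         h \<leftarrow> PT; ts \<leftarrow> shuffle I h; run_prefix A s xs ys ts }"
    by (intro bind_pmf_cong refl) (subst bind_commute_pmf[of PT], intro bind_pmf_cong refl, rule bind_commute_pmf)
  also have "\<dots> =
    do { f \<leftarrow> PX; xs \<leftarrow> shuffle I f; g \<leftarrow> PY; ys \<leftarrow> shuffle I g;
         h \<leftarrow> PT; ts \<leftarrow> shuffle I h; run_prefix A s xs ys ts }"
    by (intro bind_pmf_cong refl) (rule bind_commute_pmf)
  finally show ?thesis
    using assms by (simp add: pois_sample_eq_shuffle[of I] PX_def PY_def PT_def bind_assoc_pmf)
qed

section \<open>Returning from Poisson sample sizes to exactly \<open>s\<close> samples\<close>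

lemma bind_replicate_pmf_take:
  assumes "s \<le> N"
  shows "bind_pmf (replicate_pmf N X) (\<lambda>xs. F (take s xs)) = bind_pmf (replicate_pmf s X) F"
proof -
  have "bind_pmf (replicate_pmf N X) (\<lambda>xs. F (take s xs))
      = do { xs \<leftarrow> replicate_pmf s X; ys \<leftarrow> replicate_pmf (N - s) X; F (take s (xs @ ys)) }"
    using replicate_pmf_distrib[of s "N - s" X] assms by (simp add: bind_assoc_pmf bind_return_pmf)
  also have "\<dots> = do { xs \<leftarrow> replicate_pmf s X; ys \<leftarrow> replicate_pmf (N - s) X; F xs }"
    by (intro bind_pmf_cong refl) (auto simp: set_replicate_pmf)
  finally show ?thesis by simp
qed

text \<open>Given the three sizes, the prefixes of length \<open>s\<close> are themselves
  independent samples of size \<open>s\<close>. The truncation therefore recovers the original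
  experiment unless some phase is too short.\<close>

lemma run_prefix_pois_sample:
  "do { xs \<leftarrow> pois_sample \<Lambda> X; ys \<leftarrow> pois_sample \<Lambda> Y; ts \<leftarrow> pois_sample \<Lambda> T; run_prefix A s xs ys ts }
   = bind_pmf (pois3 (\<Lambda>, \<Lambda>, \<Lambda>)) (\<lambda>(i, j, k).
       if s \<le> i \<and> s \<le> j \<and> s \<le> k then output_dist A s X Y T else return_pmf First)"
proof -
  define out where "out i j k = (if s \<le> i \<and> s \<le> j \<and> s \<le> k then output_dist A s X Y T else return_pmf First)" for i j k
  have inner: "do { xs \<leftarrow> replicate_pmf i X; ys \<leftarrow> replicate_pmf j Y; ts \<leftarrow> replicate_pmf k T; run_prefix A s xs ys ts }
      = out i j k" for i j k
  proof (cases "s \<le> i \<and> s \<le> j \<and> s \<le> k")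
    case True
    have "do { xs \<leftarrow> replicate_pmf i X; ys \<leftarrow> replicate_pmf j Y; ts \<leftarrow> replicate_pmf k T; run_prefix A s xs ys ts }
        = do { xs \<leftarrow> replicate_pmf i X; ys \<leftarrow> replicate_pmf j Y; ts \<leftarrow> replicate_pmf k T;
               A (take s xs) (take s ys) (take s ts) }"
      using True by (intro bind_pmf_cong refl) (auto simp: run_prefix_def set_replicate_pmf)
    also have "\<dots> = do { xs \<leftarrow> replicate_pmf i X; ys \<leftarrow> replicate_pmf j Y; ts \<leftarrow> replicate_pmf s T;
               A (take s xs) (take s ys) ts }"
      using True
      by (intro bind_pmf_cong[OF refl, of "replicate_pmf i X"] bind_pmf_cong[OF refl, of "replicate_pmf j Y"]
          bind_replicate_pmf_take[where F = "A _ _"]) simp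
    also have "\<dots> = do { xs \<leftarrow> replicate_pmf i X; ys \<leftarrow> replicate_pmf s Y; ts \<leftarrow> replicate_pmf s T;
               A (take s xs) ys ts }"
      using True
      by (intro bind_pmf_cong[OF refl, of "replicate_pmf i X"]
          bind_replicate_pmf_take[where F = "\<lambda>ys. replicate_pmf s T \<bind> A _ ys"]) simp
    also have "\<dots> = output_dist A s X Y T"
      using True bind_replicate_pmf_take[of s i X
          "\<lambda>xs. replicate_pmf s Y \<bind> (\<lambda>ys. replicate_pmf s T \<bind> A xs ys)"]
      by (simp add: output_dist_def)
    finally show ?thesis using True by (simp add: out_def)
  next
    case False
    have "do { xs \<leftarrow> replicate_pmf i X; ys \<leftarrow> replicate_pmf j Y; ts \<leftarrow> replicate_pmf k T; run_prefix A s xs ys ts }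
        = do { xs \<leftarrow> replicate_pmf i X; ys \<leftarrow> replicate_pmf j Y; ts \<leftarrow> replicate_pmf k T; return_pmf First }"
      using False by (intro bind_pmf_cong refl) (auto simp: run_prefix_def set_replicate_pmf)
    then show ?thesis using False by (auto simp: out_def)
  qed
  have "do { xs \<leftarrow> pois_sample \<Lambda> X; ys \<leftarrow> pois_sample \<Lambda> Y; ts \<leftarrow> pois_sample \<Lambda> T; run_prefix A s xs ys ts }
      = do { i \<leftarrow> pois \<Lambda>; xs \<leftarrow> replicate_pmf i X; j \<leftarrow> pois \<Lambda>; ys \<leftarrow> replicate_pmf j Y;
             k \<leftarrow> pois \<Lambda>; ts \<leftarrow> replicate_pmf k T; run_prefix A s xs ys ts }"
    by (simp add: pois_sample_def bind_assoc_pmf)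
  also have "\<dots> = do { i \<leftarrow> pois \<Lambda>; j \<leftarrow> pois \<Lambda>; xs \<leftarrow> replicate_pmf i X; ys \<leftarrow> replicate_pmf j Y;
             k \<leftarrow> pois \<Lambda>; ts \<leftarrow> replicate_pmf k T; run_prefix A s xs ys ts }"
    by (intro bind_pmf_cong refl) (rule bind_commute_pmf)
  also have "\<dots> = do { i \<leftarrow> pois \<Lambda>; j \<leftarrow> pois \<Lambda>; k \<leftarrow> pois \<Lambda>; xs \<leftarrow> replicate_pmf i X; ys \<leftarrow> replicate_pmf j Y;
             ts \<leftarrow> replicate_pmf k T; run_prefix A s xs ys ts }"
    by (intro bind_pmf_cong refl) (subst bind_commute_pmf[of "pois \<Lambda>"], intro bind_pmf_cong refl, rule bind_commute_pmf)
  finally show ?thesis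
    by (simp add: inner pair_pmf_def bind_assoc_pmf bind_return_pmf out_def[symmetric])
qed

lemma pmf_First_add_Second: "pmf p First + pmf p Second = 1"
proof -
  have "(\<Sum>a\<in>{First, Second}. pmf p a) = 1"
    by (rule sum_pmf_eq_1) (use answer.exhaust in auto)
  then show ?thesis by simp
qed

text \<open>The bounds are asymmetric because the default answer is \<open>First\<close>: a shortage
  never hurts the lower bound, and the upper bound pays a union bound over three phases.\<close>

lemma poissonized_success:
  fixes K :: "nat \<times> nat \<times> nat \<Rightarrow> answer pmf"
  assumes K: "K = (\<lambda>(i, j, k). if s \<le> i \<and> s \<le> j \<and> s \<le> k then R else return_pmf First)"
  shows "pmf R First \<le> pmf (bind_pmf (pois3 (\<Lambda>, \<Lambda>, \<Lambda>)) K) First"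
    and "pmf (bind_pmf (pois3 (\<Lambda>, \<Lambda>, \<Lambda>)) K) First
      \<le> pmf R First + 3 * measure_pmf.prob (pois \<Lambda>) {..<s}"
proof -
  define M where "M = pois3 (\<Lambda>, \<Lambda>, \<Lambda>)"
  have ab: "\<bar>pmf p a\<bar> \<le> 1" for p :: "answer pmf" and a by (simp add: pmf_le_1)
  have "pmf R First = expect M (\<lambda>_. pmf R First)" by simp
  also have "\<dots> \<le> expect M (\<lambda>u. pmf (K u) First)"
    by (rule expect_mono_bounded[where B = 1 and C = 1]) (auto simp: K ab pmf_le_1)
  finally show "pmf R First \<le> pmf (bind_pmf (pois3 (\<Lambda>, \<Lambda>, \<Lambda>)) K) First"
    by (simp only: pmf_bind M_def)
  define b1 b2 b3 :: "nat \<times> nat \<times> nat \<Rightarrow> real" where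
    "b1 u = indicator {..<s} (fst u)" and "b2 u = indicator {..<s} (fst (snd u))"
    and "b3 u = indicator {..<s} (snd (snd u))" for u
  have bb: "\<bar>b1 u\<bar> \<le> 1" "\<bar>b2 u\<bar> \<le> 1" "\<bar>b3 u\<bar> \<le> 1" for u
    by (auto simp: b1_def b2_def b3_def indicator_def)
  have int: "integrable M b1" "integrable M b2" "integrable M b3"
    by (rule integrable_pmf_bounded, rule bb)+
  have "expect M (\<lambda>u. pmf (K u) First) \<le> expect M (\<lambda>u. pmf R First + b1 u + b2 u + b3 u)"
  proof (rule expect_mono_bounded[where B = 1 and C = 4])
    show "\<bar>pmf R First + b1 u + b2 u + b3 u\<bar> \<le> 4" for u
      using bb[of u] ab[of R First] by linarith
    show "pmf (K u) First \<le> pmf R First + b1 u + b2 u + b3 u" for u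
      by (cases u) (auto simp: K b1_def b2_def b3_def indicator_def)
  qed (auto simp: ab pmf_le_1)
  also have "\<dots> = pmf R First + expect M b1 + expect M b2 + expect M b3"
    using int by simp
  also have "expect M b1 = expect (map_pmf fst M) (indicator {..<s})" by (simp only: integral_map_pmf b1_def[abs_def] o_def)
  also have "expect M b2 = expect (map_pmf (fst \<circ> snd) M) (indicator {..<s})" by (simp only: integral_map_pmf b2_def[abs_def] o_def)
  also have "expect M b3 = expect (map_pmf (snd \<circ> snd) M) (indicator {..<s})" by (simp only: integral_map_pmf b3_def[abs_def] o_def)
  also have "map_pmf fst M = pois \<Lambda>" by (simp add: M_def map_fst_pair_pmf)
  also have "map_pmf (fst \<circ> snd) M = pois \<Lambda>"
    by (simp add: M_def map_fst_pair_pmf map_snd_pair_pmf flip: pmf.map_comp)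
  also have "map_pmf (snd \<circ> snd) M = pois \<Lambda>"
    by (simp add: M_def map_snd_pair_pmf flip: pmf.map_comp)
  finally show "pmf (bind_pmf (pois3 (\<Lambda>, \<Lambda>, \<Lambda>)) K) First
      \<le> pmf R First + 3 * measure_pmf.prob (pois \<Lambda>) {..<s}"
    by (simp add: pmf_bind M_def)
qed

text \<open>Success on every relabelled pair gives success on average over relabellings, and the
  averaged algorithm depends only on the patterns of the unrelabelled pair.\<close>

lemma distinguisher_on_patterns:
  assumes P: "dist_on n P" and Q: "dist_on n Q" and \<Lambda>: "\<Lambda> \<ge> 0"
    and A: "solves_distinguishability n (relabelling_class n P Q) s \<epsilon> A"
  obtains G :: "(nat \<times> nat \<times> nat) multiset \<Rightarrow> real" where "\<And>U. 0 \<le> G U \<and> G U \<le> 1"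
    and "1 - \<epsilon> \<le> expect (counts_pmf {1..n} \<Lambda> P Q P) (\<lambda>c. G (nonzero_patterns {1..n} c))"
    and "expect (counts_pmf {1..n} \<Lambda> P Q Q) (\<lambda>c. G (nonzero_patterns {1..n} c))
      \<le> \<epsilon> + 3 * measure_pmf.prob (pois \<Lambda>) {..<s}"
proof -
  define I where "I = {1..n}"
  have fin: "finite I" by (simp add: I_def)
  define F where "F c = pmf (run_on_counts I A s c) First" for c
  define S where "S = {\<pi>. \<pi> permutes I}"
  have finS: "finite S" unfolding S_def by (rule finite_permutations[OF fin])
  have "id \<in> S" by (simp add: S_def permutes_id)
  then have cS: "card S > 0" using finS card_gt_0_iff by blast
  have F: "0 \<le> F c \<and> F c \<le> 1" for c by (simp add: F_def pmf_le_1)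
  from symmetrize[OF fin, of F, OF F] obtain G :: "(nat \<times> nat \<times> nat) multiset \<Rightarrow> real"
    where G: "\<forall>U. 0 \<le> G U \<and> G U \<le> 1"
      and GE: "\<forall>p. expect (Pi_pmf I 0 p) (\<lambda>c. G (nonzero_patterns I c))
          = (\<Sum>\<pi>\<in>S. expect (Pi_pmf I 0 (p \<circ> \<pi>)) F) / card S"
    unfolding S_def by (elim exE conjE)
  note GE = GE[rule_format]
  \<comment> \<open>The inverse appears because permuting the rates by \<open>\<pi>\<close> pulls
    the mass at \<open>\<pi> x\<close> back to \<open>x\<close>.\<close>
  have perm: "Pi_pmf I 0 ((\<lambda>x. pois3 (\<Lambda> * pmf X x, \<Lambda> * pmf Y x, \<Lambda> * pmf T x)) \<circ> \<pi>)
      = counts_pmf I \<Lambda> (map_pmf (inv \<pi>) X) (map_pmf (inv \<pi>) Y) (map_pmf (inv \<pi>) T)"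
    if \<pi>: "\<pi> \<in> S" for X Y T \<pi>
  proof -
    have p: "\<pi> permutes I" using \<pi> by (simp add: S_def)
    have "pmf (map_pmf (inv \<pi>) Z) x = pmf Z (\<pi> x)" for Z :: "nat pmf" and x
      using pmf_map_inj'[OF permutes_inj[OF permutes_inv[OF p]], of Z "\<pi> x"]
      by (simp only: permutes_inverses(2)[OF p])
    then show ?thesis by (simp add: counts_pmf_def o_def del: pois3.simps)
  qed
  have E: "expect (counts_pmf I \<Lambda> X Y T) F = pmf (bind_pmf (pois3 (\<Lambda>, \<Lambda>, \<Lambda>)) (\<lambda>(i, j, k).
       if s \<le> i \<and> s \<le> j \<and> s \<le> k then output_dist A s X Y T else return_pmf First)) First"
    if "set_pmf X \<subseteq> I" "set_pmf Y \<subseteq> I" "set_pmf T \<subseteq> I" for X Y T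
    unfolding run_prefix_pois_sample[symmetric] bind_counts_pmf[OF fin that \<Lambda>, symmetric]
    by (simp add: pmf_bind F_def[abs_def])
  have supp: "set_pmf (map_pmf (inv \<pi>) P) \<subseteq> I" "set_pmf (map_pmf (inv \<pi>) Q) \<subseteq> I" if "\<pi> \<in> S" for \<pi>
    using that P Q permutes_in_image[OF permutes_inv, of \<pi> I] by (auto simp: S_def dist_on_def I_def)
  have correct: "1 - \<epsilon> \<le> pmf (output_dist A s (map_pmf (inv \<pi>) P) (map_pmf (inv \<pi>) Q) (map_pmf (inv \<pi>) P)) First"
    "1 - \<epsilon> \<le> pmf (output_dist A s (map_pmf (inv \<pi>) P) (map_pmf (inv \<pi>) Q) (map_pmf (inv \<pi>) Q)) Second"
    if "\<pi> \<in> S" for \<pi>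
  proof -
    have "inv \<pi> permutes {1..n}" using that by (simp add: S_def I_def permutes_inv)
    then have "(map_pmf (inv \<pi>) P, map_pmf (inv \<pi>) Q) \<in> relabelling_class n P Q"
      by (auto simp: relabelling_class_def)
    from bspec[OF conjunct1[OF A[unfolded solves_distinguishability_def]] this]
    show "1 - \<epsilon> \<le> pmf (output_dist A s (map_pmf (inv \<pi>) P) (map_pmf (inv \<pi>) Q) (map_pmf (inv \<pi>) P)) First"
      "1 - \<epsilon> \<le> pmf (output_dist A s (map_pmf (inv \<pi>) P) (map_pmf (inv \<pi>) Q) (map_pmf (inv \<pi>) Q)) Second"
      by simp_all
  qed
  show ?thesis
  proof (rule that[OF G[rule_format]])
    have "1 - \<epsilon> \<le> expect (Pi_pmf I 0 ((\<lambda>x. pois3 (\<Lambda> * pmf P x, \<Lambda> * pmf Q x, \<Lambda> * pmf P x)) \<circ> \<pi>)) F"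
      if \<pi>: "\<pi> \<in> S" for \<pi>
      unfolding perm[OF \<pi>] E[OF supp(1)[OF \<pi>] supp(2)[OF \<pi>] supp(1)[OF \<pi>]]
      by (rule order_trans[OF correct(1)[OF \<pi>] poissonized_success(1)[OF refl]])
    then have "card S * (1 - \<epsilon>)
      \<le> (\<Sum>\<pi>\<in>S. expect (Pi_pmf I 0 ((\<lambda>x. pois3 (\<Lambda> * pmf P x, \<Lambda> * pmf Q x, \<Lambda> * pmf P x)) \<circ> \<pi>)) F)"
      by (intro sum_bounded_below)
    then show "1 - \<epsilon> \<le> expect (counts_pmf {1..n} \<Lambda> P Q P) (\<lambda>c. G (nonzero_patterns {1..n} c))"
      unfolding counts_pmf_def I_def[symmetric] GE using cS by (simp add: field_simps)
  next
    define \<eta> where "\<eta> = \<epsilon> + 3 * measure_pmf.prob (pois \<Lambda>) {..<s}"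
    have "expect (Pi_pmf I 0 ((\<lambda>x. pois3 (\<Lambda> * pmf P x, \<Lambda> * pmf Q x, \<Lambda> * pmf Q x)) \<circ> \<pi>)) F \<le> \<eta>"
      if \<pi>: "\<pi> \<in> S" for \<pi>
    proof -
      define R where "R = output_dist A s (map_pmf (inv \<pi>) P) (map_pmf (inv \<pi>) Q) (map_pmf (inv \<pi>) Q)"
      have "pmf R First \<le> \<epsilon>" using correct(2)[OF \<pi>] pmf_First_add_Second[of R] by (simp add: R_def)
      then show ?thesis
        unfolding perm[OF \<pi>] E[OF supp(1)[OF \<pi>] supp(2)[OF \<pi>] supp(2)[OF \<pi>]] R_def[symmetric] \<eta>_def
        by (intro order_trans[OF poissonized_success(2)[OF refl]]) simp
    qed
    then have "(\<Sum>\<pi>\<in>S. expect (Pi_pmf I 0 ((\<lambda>x. pois3 (\<Lambda> * pmf P x, \<Lambda> * pmf Q x, \<Lambda> * pmf Q x)) \<circ> \<pi>)) F)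
        \<le> card S * \<eta>"
      by (intro sum_bounded_above)
    then show "expect (counts_pmf {1..n} \<Lambda> P Q Q) (\<lambda>c. G (nonzero_patterns {1..n} c)) \<le> \<eta>"
      unfolding counts_pmf_def I_def[symmetric] GE using cS by (simp add: field_simps)
  qed
qed

section \<open>The lower bound\<close>

text \<open>Both worlds are compared with one reference that does not mention \<open>T\<close>, so
  that applying this with \<open>T = P\<close> and with \<open>T = Q\<close> bounds their difference
  by the triangle inequality.\<close>

lemma worlds_close:
  fixes G :: "(nat \<times> nat \<times> nat) multiset \<Rightarrow> real" and s :: nat
  assumes P: "dist_on n P" and Q: "dist_on n Q" and wd: "weakly_disjoint P Q"
    and small: "\<And>x. s * pmf P x \<le> 1"
    and G: "\<And>U. 0 \<le> G U \<and> G U \<le> 1"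
    and S: "S = (\<Sum>x | x \<in> {1..n} \<and> pmf P x = pmf Q x. (2 * real s * pmf P x)\<^sup>2)"
    and \<theta>: "\<theta> \<ge> 3 \<or> S > 0 \<and> \<theta> \<ge> 18 * exp 3 / sqrt S"
    and T: "T = P \<or> T = Q"
    and d: "d2 = (\<Sum>x\<in>{1..n}. \<bar>pmf P x - pmf Q x\<bar> ^ 2)"
      "d3 = (\<Sum>x\<in>{1..n}. \<bar>pmf P x - pmf Q x\<bar> ^ 3)"
    and B: "B = {x \<in> {1..n}. pmf P x \<noteq> pmf Q x}"
    and \<Phi>: "\<Phi> = (\<lambda>U. expect (Pi_pmf {x \<in> {1..n}. pmf P x = pmf Q x} 0
                 (\<lambda>x. pois3 (2 * real s * pmf P x, 2 * real s * pmf P x, 2 * real s * pmf P x)))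
                 (\<lambda>c. G (nonzero_patterns {x \<in> {1..n}. pmf P x = pmf Q x} c + U)))"
  shows "\<bar>expect (counts_pmf {1..n} (2 * real s) P Q T) (\<lambda>c. G (nonzero_patterns {1..n} c))
      - expect (pois3 (\<Sum>x\<in>B. 2 * real s * pmf P x, \<Sum>x\<in>B. 2 * real s * pmf Q x, \<Sum>x\<in>B. 2 * real s * pmf P x))
          (\<lambda>v. \<Phi> (singles v))\<bar>
      \<le> 8 * \<theta> * ((real s)\<^sup>2 * d2) + 32 / 3 * (real s ^ 3 * d3)"
proof -
  define D where "D = {x \<in> {1..n}. pmf P x = pmf Q x}"
  define w where "w x = \<bar>pmf P x - pmf Q x\<bar>" for x
  have fin: "finite D" "finite B" "D \<inter> B = {}" and I: "{1..n} = B \<union> D"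
    by (auto simp: D_def B)
  define q where "q = (\<lambda>x. pois3 (2 * real s * pmf P x, 2 * real s * pmf Q x, 2 * real s * pmf T x))"
  define \<mu> where "\<mu> = Pi_pmf D 0 (\<lambda>x. pois3 (2 * real s * pmf P x, 2 * real s * pmf P x, 2 * real s * pmf P x))"
  have \<mu>: "\<mu> = Pi_pmf D 0 q"
    unfolding \<mu>_def using T by (intro Pi_pmf_cong refl) (auto simp: D_def q_def)
  have \<Phi>D: "\<Phi> = (\<lambda>U. expect (Pi_pmf D 0 q) (\<lambda>c. G (nonzero_patterns D c + U)))"
    unfolding \<Phi> D_def[symmetric] \<mu>_def[symmetric] \<mu> ..
  have step: "3 * \<bar>\<Phi> (U + {#v#}) - \<Phi> U\<bar> \<le> \<theta>" if v: "total v \<in> {1, 2}" for v U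
    using \<theta>
  proof
    \<comment> \<open>Without noise the trivial bound remains: \<open>\<Phi>\<close> takes values in
      [0, 1], so no shift exceeds 1.\<close>
    assume "\<theta> \<ge> 3"
    have G1: "\<bar>G U\<bar> \<le> 1" for U using G[of U] by simp
    have "0 \<le> \<Phi> U \<and> \<Phi> U \<le> 1" for U
      using G abs_expect_le[OF G1] unfolding \<Phi>
      by (auto intro!: Bochner_Integration.integral_nonneg dest: abs_le_D1)
    then have "0 \<le> \<Phi> U" "\<Phi> U \<le> 1" "0 \<le> \<Phi> (U + {#v#})" "\<Phi> (U + {#v#}) \<le> 1" by blast+
    with \<open>\<theta> \<ge> 3\<close> show ?thesis by (auto simp: abs_if)
  next
    assume S0: "S > 0 \<and> \<theta> \<ge> 18 * exp 3 / sqrt S"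
    have "\<bar>\<Phi> (U + {#v#}) - \<Phi> U\<bar> \<le> 6 * exp 3 / sqrt S"
      unfolding \<Phi>D \<mu>[symmetric]
    proof (rule pois3_shift[OF fin(1) _ _ _ _ v \<mu>_def])
      show "0 \<le> 2 * real s * pmf P d \<and> 2 * real s * pmf P d \<le> 2" for d
        using small[of d] by simp
      show "\<bar>G U\<bar> \<le> 1" for U using G[of U] by simp
      show "S = (\<Sum>d\<in>D. (2 * real s * pmf P d)\<^sup>2)" by (simp only: S D_def)
    qed (use S0 in simp)
    with S0 show ?thesis by simp
  qed
  have rate: "0 \<le> 2 * real s * pmf P x \<and> 0 \<le> 2 * real s * pmf Q x \<and> 0 \<le> 2 * real s * pmf T x" for x
    by simp
  \<comment> \<open>\<open>P\<close> and \<open>Q\<close> agree on \<open>D\<close>, hence have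
    equal mass on its complement \<open>B\<close>: the number of test samples falling into
    \<open>B\<close> carries no information on \<open>T\<close>.\<close>
  have ref: "(\<Sum>x\<in>B. 2 * real s * pmf T x) = (\<Sum>x\<in>B. 2 * real s * pmf P x)"
  proof -
    have sum1: "(\<Sum>x\<in>B. pmf Z x) + (\<Sum>x\<in>D. pmf Z x) = 1" if "dist_on n Z" for Z
    proof -
      have "(\<Sum>x\<in>B \<union> D. pmf Z x) = 1"
        using that by (intro sum_pmf_eq_1) (auto simp: dist_on_def I[symmetric])
      then show ?thesis using fin by (subst (asm) sum.union_disjoint) auto
    qed
    have "(\<Sum>x\<in>D. pmf T x) = (\<Sum>x\<in>D. pmf P x)"
      using T by (intro sum.cong) (auto simp: D_def)
    then have "(\<Sum>x\<in>B. pmf T x) = (\<Sum>x\<in>B. pmf P x)"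
      using sum1[OF P] sum1[of T] P Q T by auto
    then show ?thesis by (simp flip: sum_distrib_left)
  qed
  have "\<bar>expect (counts_pmf {1..n} (2 * real s) P Q T) (\<lambda>c. G (nonzero_patterns {1..n} c))
      - expect (pois3 (\<Sum>x\<in>B. 2 * real s * pmf P x, \<Sum>x\<in>B. 2 * real s * pmf Q x, \<Sum>x\<in>B. 2 * real s * pmf T x))
          (\<lambda>v. \<Phi> (singles v))\<bar>
    \<le> (\<Sum>x\<in>B. \<theta> * (2 * real s * pmf P x + 2 * real s * pmf Q x + 2 * real s * pmf T x)\<^sup>2 / 2
         + (2 * real s * pmf P x + 2 * real s * pmf Q x + 2 * real s * pmf T x) ^ 3 / 6)"
    unfolding counts_pmf_def I
    using poissonized_vs_singles[OF fin rate G q_def \<Phi>D step] by (simp only: q_def)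
  also have "\<dots> \<le> (\<Sum>x\<in>B. \<theta> * (4 * real s * w x)\<^sup>2 / 2 + (4 * real s * w x) ^ 3 / 6)"
  proof (intro sum_mono)
    fix x assume "x \<in> B"
    have "\<theta> \<ge> 0"
    proof -
      have "18 * exp 3 / sqrt S \<ge> 0" if "S > 0" using that by simp
      with \<theta> show ?thesis by linarith
    qed
    \<comment> \<open>On \<open>B\<close> one of the two probabilities vanishes, so their sum equals
      their distance \<open>w x\<close>, and \<open>T\<close> adds at most \<open>w x\<close>
      more.\<close>
    have "pmf P x + pmf Q x + pmf T x \<le> 2 * w x"
      using wd[unfolded weakly_disjoint_def, rule_format, of x] T \<open>x \<in> B\<close> by (auto simp: w_def B)
    then have "2 * real s * (pmf P x + pmf Q x + pmf T x) \<le> 2 * real s * (2 * w x)"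
      by (intro mult_left_mono) auto
    then have le: "2 * real s * pmf P x + 2 * real s * pmf Q x + 2 * real s * pmf T x \<le> 4 * real s * w x"
      by (simp add: algebra_simps)
    show "\<theta> * (2 * real s * pmf P x + 2 * real s * pmf Q x + 2 * real s * pmf T x)\<^sup>2 / 2
         + (2 * real s * pmf P x + 2 * real s * pmf Q x + 2 * real s * pmf T x) ^ 3 / 6
      \<le> \<theta> * (4 * real s * w x)\<^sup>2 / 2 + (4 * real s * w x) ^ 3 / 6"
      using \<open>\<theta> \<ge> 0\<close> rate[of x]
      by (intro add_mono divide_right_mono mult_left_mono power_mono le) auto
  qed
  also have "\<dots> = 8 * \<theta> * ((real s)\<^sup>2 * (\<Sum>x\<in>B. w x ^ 2)) + 32 / 3 * (real s ^ 3 * (\<Sum>x\<in>B. w x ^ 3))"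
    by (simp add: sum.distrib sum_distrib_left power_mult_distrib mult_ac)
  also have "(\<Sum>x\<in>B. w x ^ 2) = d2"
    unfolding d w_def using fin by (intro sum.mono_neutral_left) (auto simp: B)
  also have "(\<Sum>x\<in>B. w x ^ 3) = d3"
    unfolding d w_def using fin by (intro sum.mono_neutral_left) (auto simp: B)
  finally show ?thesis by (simp only: ref)
qed

text \<open>
  If the mass where \<open>P = Q\<close> is too small to provide noise, the trivial \<open>\<theta> = 3\<close> suffices, since
  then collisions where \<open>P \<noteq> Q\<close> are already rare.
\<close>

lemma smoothness_dominates:
  fixes s :: nat and d2 D2 :: real
  assumes s: "s > 0" and nn: "d2 \<ge> 0" "D2 \<ge> 0"
    and le: "200000 * (real s * d2) \<le> sqrt (4 * D2 + d2)"
  obtains \<theta> where "\<theta> \<ge> 3 \<or> 4 * (real s)\<^sup>2 * D2 > 0 \<and> \<theta> \<ge> 18 * exp 3 / sqrt (4 * (real s)\<^sup>2 * D2)"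
    and "\<theta> * ((real s)\<^sup>2 * d2) \<le> 1 / 200"
proof (cases "4 * D2 \<le> d2")
  case True
  have "(200000 * (real s * d2))\<^sup>2 \<le> (sqrt (4 * D2 + d2))\<^sup>2"
    using nn le by (intro power_mono) auto
  also have "\<dots> \<le> 2 * d2" using True nn by simp
  finally have le2: "(40000000000 * ((real s)\<^sup>2 * d2)) * d2 \<le> 2 * d2" by (simp add: power2_eq_square algebra_simps)
  have "3 * ((real s)\<^sup>2 * d2) \<le> 1 / 200"
  proof (cases "d2 = 0")
    case False
    then have "d2 > 0" using nn by linarith
    then have "40000000000 * ((real s)\<^sup>2 * d2) \<le> 2" by (rule mult_right_le_imp_le[OF le2])
    then show ?thesis by linarith
  qed simp
  then show ?thesis by (intro that[of 3]) auto
next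
  case False
  then have D: "D2 > 0" using nn by simp
  \<comment> \<open>Here \<open>d2 < 4 * D2\<close>, so the sum is below \<open>8 * D2\<close>; 9 is
    the next square.\<close>
  have "sqrt (4 * D2 + d2) \<le> sqrt (3\<^sup>2 * D2)" using False D by (intro real_sqrt_le_mono) simp
  also have "\<dots> = 3 * sqrt D2" by (simp only: real_sqrt_mult real_sqrt_abs)
  finally have "200000 * (real s * d2) \<le> 3 * sqrt D2" using le by simp
  then have 1: "real s * d2 / sqrt D2 \<le> 3 / 200000" using D by (simp add: field_simps)
  have sq: "sqrt (4 * (real s)\<^sup>2 * D2) = 2 * real s * sqrt D2"
  proof -
    have "4 * (real s)\<^sup>2 * D2 = (2 * real s)\<^sup>2 * D2" by (simp add: power2_eq_square)
    then show ?thesis by (simp only: real_sqrt_mult real_sqrt_abs)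
  qed
  have e3: "exp 3 \<le> (27 :: real)"
  proof -
    have "exp (3 :: real) = exp 1 ^ 3" by (simp flip: exp_of_nat_mult)
    also have "\<dots> \<le> 3 ^ 3" using exp_le by (intro power_mono) auto
    finally show ?thesis by simp
  qed
  have "18 * exp 3 / sqrt (4 * (real s)\<^sup>2 * D2) * ((real s)\<^sup>2 * d2) = 9 * exp 3 * (real s * d2 / sqrt D2)"
    unfolding sq using s D by (simp add: power2_eq_square)
  \<comment> \<open>This estimate dictates the size of the universal constant: 729 / 200000 must
    stay below 1/200.\<close>
  also have "\<dots> \<le> 9 * 27 * (3 / 200000)" using e3 1 nn D by (intro mult_mono) auto
  finally have "18 * exp 3 / sqrt (4 * (real s)\<^sup>2 * D2) * ((real s)\<^sup>2 * d2) \<le> 1 / 200" by simp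
  with s D show ?thesis by (intro that[of "18 * exp 3 / sqrt (4 * (real s)\<^sup>2 * D2)"]) auto
qed

text \<open>Under weak disjointness \<open>(p + q)\<^sup>2\<close> is \<open>4 p\<^sup>2\<close>
  where \<open>p = q\<close> and \<open>(p - q)\<^sup>2\<close> elsewhere. The squared 2-norm of
  \<open>P + Q\<close> thus separates into the noise available on equal elements and the signal on
  the others.\<close>

lemma sampling_bounds:
  fixes s :: nat
  assumes P: "dist_on n P" and Q: "dist_on n Q" and wd: "weakly_disjoint P Q"
    and c: "c > 0"
    and le: "real s \<le> Min {0.25 / lp_norm 3 n (\<lambda>x. pmf P x - pmf Q x),
                       1 / linf_norm n (pmf P),
                       1 / linf_norm n (pmf Q),
                       (1 / c) * (lp_norm 2 n (\<lambda>x. pmf P x + pmf Q x)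
                                   / (lp_norm 2 n (\<lambda>x. pmf P x - pmf Q x))\<^sup>2)}"
  shows "real s * pmf P x \<le> 1"
    and "real s ^ 3 * (\<Sum>x\<in>{1..n}. \<bar>pmf P x - pmf Q x\<bar> ^ 3) \<le> 1 / 64"
    and "c * (real s * (\<Sum>x\<in>{1..n}. \<bar>pmf P x - pmf Q x\<bar> ^ 2))
      \<le> sqrt (4 * (\<Sum>x | x \<in> {1..n} \<and> pmf P x = pmf Q x. (pmf P x)\<^sup>2)
              + (\<Sum>x\<in>{1..n}. \<bar>pmf P x - pmf Q x\<bar> ^ 2))"
proof -
  define d2 where "d2 = (\<Sum>x\<in>{1..n}. \<bar>pmf P x - pmf Q x\<bar> ^ 2)"
  define d3 where "d3 = (\<Sum>x\<in>{1..n}. \<bar>pmf P x - pmf Q x\<bar> ^ 3)"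
  have nn: "d2 \<ge> 0" "d3 \<ge> 0" by (auto simp: d2_def d3_def intro: sum_nonneg)
  have s3: "real s \<le> 0.25 / root 3 d3" and sP: "real s \<le> 1 / linf_norm n (pmf P)"
    and s2: "real s \<le> (1 / c) * (lp_norm 2 n (\<lambda>x. pmf P x + pmf Q x) / (lp_norm 2 n (\<lambda>x. pmf P x - pmf Q x))\<^sup>2)"
    using le by (simp_all add: Min_ge_iff lp_norm_def d3_def)
  show "real s * pmf P x \<le> 1"
  proof (cases "x \<in> {1..n}")
    case True
    then have x: "pmf P x \<le> linf_norm n (pmf P)"
      unfolding linf_norm_def by (intro Max_ge) (auto intro!: image_eqI[of _ _ x])
    show ?thesis
    proof (cases "pmf P x = 0")
      case False
      then have "linf_norm n (pmf P) > 0" using x pmf_nonneg[of P x] by linarith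
      then have "real s * linf_norm n (pmf P) \<le> 1" using sP by (simp add: field_simps)
      then show ?thesis using x mult_left_mono[OF x, of "real s"] by simp
    qed simp
  next
    case False
    then have "pmf P x = 0" using P by (auto simp: dist_on_def set_pmf_iff)
    then show ?thesis by simp
  qed
  show "real s ^ 3 * d3 \<le> 1 / 64"
  \<comment> \<open>Division by a zero norm yields 0, not infinity, so this case is settled without
    the quotient.\<close>
  proof (cases "d3 = 0")
    case False
    then have "root 3 d3 > 0" using nn by simp
    then have "real s * root 3 d3 \<le> 1 / 4" using s3 by (simp add: field_simps)
    then have "(real s * root 3 d3) ^ 3 \<le> (1 / 4) ^ 3" using nn by (intro power_mono) auto
    moreover have "root 3 d3 ^ 3 = d3" using nn by (intro real_root_pow_pos2) auto
    ultimately have "real s ^ 3 * d3 \<le> (1 / 4) ^ 3" by (simp only: power_mult_distrib)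
    then show ?thesis by (simp add: power3_eq_cube)
  qed simp
  define D2 where "D2 = (\<Sum>x | x \<in> {1..n} \<and> pmf P x = pmf Q x. (pmf P x)\<^sup>2)"
  have D2: "D2 = (\<Sum>x\<in>{1..n}. if pmf P x = pmf Q x then (pmf P x)\<^sup>2 else 0)"
    unfolding D2_def by (subst sum.inter_filter[symmetric]) auto
  have "(\<Sum>x\<in>{1..n}. \<bar>pmf P x + pmf Q x\<bar> ^ 2) = 4 * D2 + d2"
    unfolding D2 d2_def sum_distrib_left sum.distrib[symmetric]
  proof (intro sum.cong refl)
    fix x
    show "\<bar>pmf P x + pmf Q x\<bar> ^ 2
      = 4 * (if pmf P x = pmf Q x then (pmf P x)\<^sup>2 else 0) + \<bar>pmf P x - pmf Q x\<bar> ^ 2"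
      using wd[unfolded weakly_disjoint_def, rule_format, of x] by (auto simp: power2_eq_square)
  qed
  then have N: "lp_norm 2 n (\<lambda>x. pmf P x + pmf Q x) = sqrt (4 * D2 + d2)"
    by (simp add: lp_norm_def sqrt_def)
  have M: "(lp_norm 2 n (\<lambda>x. pmf P x - pmf Q x))\<^sup>2 = d2"
    using nn by (simp add: lp_norm_def d2_def flip: sqrt_def)
  have "D2 \<ge> 0" unfolding D2_def by (intro sum_nonneg) auto
  then show "c * (real s * d2) \<le> sqrt (4 * D2 + d2)"
    using s2 nn c unfolding N M by (cases "d2 = 0") (auto simp: field_simps)
qed

text \<open>The error budget: each world is within 8/200 + 1/6 of the reference, so the two
  probabilities of \<open>First\<close> differ by less than 0.42. An algorithm with error at most
  1/10 would make them differ by at least 0.7, even after losing 3/30 to short samples.\<close>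

lemma no_distinguisher:
  fixes s :: nat
  assumes P: "dist_on n P" and Q: "dist_on n Q" and wd: "weakly_disjoint P Q"
    and s: "s > 0" "(2 / exp 1) ^ s \<le> (1 / 30 :: real)" and \<epsilon>: "\<epsilon> \<le> 1 / 10"
    and le: "real s \<le> Min {0.25 / lp_norm 3 n (\<lambda>x. pmf P x - pmf Q x),
                       1 / linf_norm n (pmf P),
                       1 / linf_norm n (pmf Q),
                       (1 / 200000) * (lp_norm 2 n (\<lambda>x. pmf P x + pmf Q x)
                                   / (lp_norm 2 n (\<lambda>x. pmf P x - pmf Q x))\<^sup>2)}"
  shows "\<not> solves_distinguishability n (relabelling_class n P Q) s \<epsilon> A"
proof
  assume A: "solves_distinguishability n (relabelling_class n P Q) s \<epsilon> A"
  define D2 where "D2 = (\<Sum>x | x \<in> {1..n} \<and> pmf P x = pmf Q x. (pmf P x)\<^sup>2)"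
  define d2 where "d2 = (\<Sum>x\<in>{1..n}. \<bar>pmf P x - pmf Q x\<bar> ^ 2)"
  define d3 where "d3 = (\<Sum>x\<in>{1..n}. \<bar>pmf P x - pmf Q x\<bar> ^ 3)"
  note bounds = sampling_bounds[OF P Q wd _ le, folded d2_def d3_def D2_def, simplified]
  have nn: "d2 \<ge> 0" "D2 \<ge> 0" by (auto simp: d2_def D2_def intro!: sum_nonneg)
  obtain \<theta> where \<theta>: "\<theta> \<ge> 3 \<or> 4 * (real s)\<^sup>2 * D2 > 0 \<and> \<theta> \<ge> 18 * exp 3 / sqrt (4 * (real s)\<^sup>2 * D2)"
    "\<theta> * ((real s)\<^sup>2 * d2) \<le> 1 / 200"
    using smoothness_dominates[OF s(1) nn bounds(3)] by blast
  have S: "4 * (real s)\<^sup>2 * D2 = (\<Sum>x | x \<in> {1..n} \<and> pmf P x = pmf Q x. (2 * real s * pmf P x)\<^sup>2)"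
    by (simp add: D2_def sum_distrib_left power_mult_distrib)
  obtain G :: "(nat \<times> nat \<times> nat) multiset \<Rightarrow> real" where G: "\<And>U. 0 \<le> G U \<and> G U \<le> 1"
    and GP: "1 - \<epsilon> \<le> expect (counts_pmf {1..n} (2 * real s) P Q P) (\<lambda>c. G (nonzero_patterns {1..n} c))"
    and GQ: "expect (counts_pmf {1..n} (2 * real s) P Q Q) (\<lambda>c. G (nonzero_patterns {1..n} c))
      \<le> \<epsilon> + 3 * measure_pmf.prob (pois (2 * real s)) {..<s}"
    by (rule distinguisher_on_patterns[OF P Q _ A, of "2 * real s"]) auto
  have "8 * \<theta> * ((real s)\<^sup>2 * d2) + 32 / 3 * (real s ^ 3 * d3)
      = 8 * (\<theta> * ((real s)\<^sup>2 * d2)) + 32 / 3 * (real s ^ 3 * d3)"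
    by simp
  also have "\<dots> \<le> 8 / 200 + 1 / 6" using \<theta>(2) bounds(2) by linarith
  finally have "8 * \<theta> * ((real s)\<^sup>2 * d2) + 32 / 3 * (real s ^ 3 * d3) \<le> 8 / 200 + 1 / 6" .
  moreover note worlds_close[where G = G, OF P Q wd bounds(1) G S \<theta>(1) disjI1[OF refl] d2_def d3_def refl refl]
    worlds_close[where G = G, OF P Q wd bounds(1) G S \<theta>(1) disjI2[OF refl] d2_def d3_def refl refl]
  moreover have "3 * measure_pmf.prob (pois (2 * real s)) {..<s} \<le> 1 / 10"
    using pois_lower_tail[of s] s(2) by simp
  ultimately show False using GP GQ \<epsilon> by linarith
qed

theorem theorem2:
  "\<exists>c::real. c > 0 \<and>
    (\<forall>(C::real) (k::real). C > 0 \<longrightarrow> k > 0 \<longrightarrow>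
      (\<exists>s0::nat. \<forall>(n::nat) (P::nat pmf) (Q::nat pmf) (s::nat).
        dist_on n P \<longrightarrow> dist_on n Q \<longrightarrow> P \<noteq> Q \<longrightarrow> weakly_disjoint P Q \<longrightarrow> s \<ge> s0 \<longrightarrow>
        real s \<le> Min {0.25 / lp_norm 3 n (\<lambda>x. pmf P x - pmf Q x),
                       1 / linf_norm n (pmf P),
                       1 / linf_norm n (pmf Q),
                       (1 / c) * (lp_norm 2 n (\<lambda>x. pmf P x + pmf Q x)
                                   / (lp_norm 2 n (\<lambda>x. pmf P x - pmf Q x))\<^sup>2)} \<longrightarrow>
        \<not> (\<exists>A. solves_distinguishability n (relabelling_class n P Q) s
                 (C * (1 + ln (real s)) powr k / (real s)\<^sup>2) A)))"
proof (intro exI[of _ "200000 :: real"] conjI allI impI)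
  fix C k :: real
  assume "C > 0" "k > 0"
  have "(\<lambda>s. C * (1 + ln (real s)) powr k / (real s)\<^sup>2) \<longlonglongrightarrow> 0"
    using \<open>C > 0\<close> \<open>k > 0\<close> by real_asymp
  then have "eventually (\<lambda>s. C * (1 + ln (real s)) powr k / (real s)\<^sup>2 < 1 / 10) sequentially"
    by (rule order_tendstoD) simp
  \<comment> \<open>The quadratic Taylor bound gives e at least 5/2, so the ratio is below
    1.\<close>
  moreover have "(\<lambda>s. (2 / exp 1 :: real) ^ s) \<longlonglongrightarrow> 0"
    using exp_lower_Taylor_quadratic[of "1 :: real"] by (intro LIMSEQ_realpow_zero) auto
  then have "eventually (\<lambda>s. (2 / exp 1 :: real) ^ s < 1 / 30) sequentially"
    by (rule order_tendstoD) simp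
  moreover have "eventually (\<lambda>s :: nat. s > 0) sequentially" by (rule eventually_gt_at_top)
  ultimately have "eventually (\<lambda>s. C * (1 + ln (real s)) powr k / (real s)\<^sup>2 < 1 / 10
      \<and> (2 / exp 1 :: real) ^ s < 1 / 30 \<and> s > 0) sequentially"
    by eventually_elim simp
  then obtain s0 where s0: "\<And>s. s \<ge> s0 \<Longrightarrow> C * (1 + ln (real s)) powr k / (real s)\<^sup>2 < 1 / 10
      \<and> (2 / exp 1 :: real) ^ s < 1 / 30 \<and> s > 0"
    unfolding eventually_sequentially by blast
  show "\<exists>s0::nat. \<forall>(n::nat) (P::nat pmf) (Q::nat pmf) (s::nat).
        dist_on n P \<longrightarrow> dist_on n Q \<longrightarrow> P \<noteq> Q \<longrightarrow> weakly_disjoint P Q \<longrightarrow> s \<ge> s0 \<longrightarrow>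
        real s \<le> Min {0.25 / lp_norm 3 n (\<lambda>x. pmf P x - pmf Q x),
                       1 / linf_norm n (pmf P),
                       1 / linf_norm n (pmf Q),
                       (1 / 200000) * (lp_norm 2 n (\<lambda>x. pmf P x + pmf Q x)
                                   / (lp_norm 2 n (\<lambda>x. pmf P x - pmf Q x))\<^sup>2)} \<longrightarrow>
        \<not> (\<exists>A. solves_distinguishability n (relabelling_class n P Q) s
                 (C * (1 + ln (real s)) powr k / (real s)\<^sup>2) A)"
  proof (intro exI[of _ s0] allI impI notI)
    fix n P Q s
    assume asm: "dist_on n P" "dist_on n Q" "weakly_disjoint P Q" "s \<ge> s0"
      and le: "real s \<le> Min {0.25 / lp_norm 3 n (\<lambda>x. pmf P x - pmf Q x),
                       1 / linf_norm n (pmf P),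
                       1 / linf_norm n (pmf Q),
                       (1 / 200000) * (lp_norm 2 n (\<lambda>x. pmf P x + pmf Q x)
                                   / (lp_norm 2 n (\<lambda>x. pmf P x - pmf Q x))\<^sup>2)}"
      and "\<exists>A. solves_distinguishability n (relabelling_class n P Q) s
                 (C * (1 + ln (real s)) powr k / (real s)\<^sup>2) A"
    then show False
      using no_distinguisher[OF asm(1-3) _ _ _ le] s0[OF asm(4)] less_imp_le by blast
  qed
qed simp

end
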